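(* The subriemannian geodesic flows on $\mathbb{S}^7_{\mathrm{T},4}$, on $\mathbb{S}^7_{\mathrm{T},5}$, on $\mathbb{S}^7_{\mathrm{T},6}=\mathbb{S}^7_{\mathrm{H}}$, and on $\mathbb{S}^7_{\mathrm{QH}}$ are completely integrable in the sense of Liouville.
   Context: Let $A_1,\dots,A_7\in\mathfrak{so}(8)$ be a fixed family of real skew-symmetric $8\times 8$ matrices with $A_iA_j+A_jA_i=-2\delta_{ij}I$ for $i,j=1,\dots,7$. Let $\langle\cdot,\cdot\rangle$ be the Euclidean inner product on $\mathbb{R}^8$ and $\mathbb{S}^7\subset\mathbb{R}^8$ the unit sphere with its standard Riemannian metric. For every $q\in\mathbb{S}^7$ the vectors $A_1q,\dots,A_7q$ form an orthonormal basis of $T_q\mathbb{S}^7$. Consider the following bracket generating distributions on $\mathbb{S}^7$: $(\mathcal{D}_j)_q=\mathrm{span}\{A_1q,\dots,A_jq\}$ for $j=4,5,6$, and $(\mathcal{D}_{\mathrm{QH}})_q$ = the orthogonal complement in $T_q\mathbb{S}^7$ of $\mathrm{span}\{A_6q,A_7q,A_6A_7q\}$. With $g$ the restriction of the standard Riemannian metric to the respective distribution, one obtains the subriemannian (SR) manifolds $\mathbb{S}^7_{\mathrm{T},j}=(\mathbb{S}^7,\mathcal{D}_j,g)$, $j=4,5,6$, and $\mathbb{S}^7_{\mathrm{QH}}=(\mathbb{S}^7,\mathcal{D}_{\mathrm{QH}},g)$. One writes $\mathbb{S}^7_{\mathrm{H}}=\mathbb{S}^7_{\mathrm{T},6}$.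 The standard metric is used to identify $T^*\mathbb{S}^7\cong T\mathbb{S}^7\cong\{(q,\xi)\in\mathbb{R}^8\times\mathbb{R}^8 : |q|=1,\ \langle q,\xi\rangle=0\}$, equipped with the canonical symplectic form of the cotangent bundle. The SR Hamiltonians are $H_{\mathrm{sub},j}(q,\xi)=\frac12\sum_{i=1}^j\langle A_iq,\xi\rangle^2$ for $j=4,5,6$, and $H_{\mathrm{sub},\mathrm{QH}}(q,\xi)=\frac12\|\xi\|^2-\frac12\big(\langle A_6q,\xi\rangle^2+\langle A_7q,\xi\rangle^2+\langle A_6A_7q,\xi\rangle^2\big)$. The SR geodesic flow is the Hamiltonian flow on $T^*\mathbb{S}^7$ of the corresponding SR Hamiltonian. A Hamiltonian system $(N,\omega,H)$ on a $2n$-dimensional symplectic manifold is completely integrable in the sense of Liouville if there exist $n$ functionally independent (i.e. with differentials linearly independent almost everywhere) pairwise Poisson commuting first integrals $F_1,\dots,F_n\in C^\infty(N)$ with $F_n=H$. *)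

theory Defs
  imports "HOL-Analysis.Analysis"
begin

section \<open>Smoothness\<close>

(* On an open subset of a Euclidean space, Ck_on k f S says that f is of class C^k there: all
   directional derivatives are iterated k times and the result is continuous. *)
primrec Ck_on :: "nat \<Rightarrow> ('a::real_normed_vector \<Rightarrow> 'b::real_normed_vector) \<Rightarrow> 'a set \<Rightarrow> bool" where
  "Ck_on 0 f S \<longleftrightarrow> continuous_on S f"
| "Ck_on (Suc k) f S \<longleftrightarrow>
     (\<forall>x\<in>S. f differentiable (at x)) \<and> (\<forall>v. Ck_on k (\<lambda>x. frechet_derivative f (at x) v) S)"

definition smooth_on :: "('a::real_normed_vector \<Rightarrow> 'b::real_normed_vector) \<Rightarrow> 'a set \<Rightarrow> bool" where
  "smooth_on f S \<longleftrightarrow> (\<forall>k. Ck_on k f S)"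


section \<open>Calculus on a submanifold of a Euclidean space\<close>

text \<open>Throughout, \<open>N\<close> is meant to be an embedded smooth submanifold of the Euclidean space
  \<open>'a\<close>; \<open>'e\<close> is a Euclidean space of the same dimension as \<open>N\<close> on which charts are modelled.\<close>

definition smooth_on_submanifold :: "'a::euclidean_space set \<Rightarrow> ('a \<Rightarrow> real) \<Rightarrow> bool" where
  "smooth_on_submanifold N F \<longleftrightarrow>
     (\<forall>p\<in>N. \<exists>U G. open U \<and> p \<in> U \<and> smooth_on G U \<and> (\<forall>x\<in>U \<inter> N. G x = F x))"

definition tangent_space :: "'a::euclidean_space set \<Rightarrow> 'a \<Rightarrow> 'a set" where
  "tangent_space N p =
     {w. \<exists>(\<gamma>::real \<Rightarrow> 'a) \<epsilon>. \<epsilon> > 0 \<and> smooth_on \<gamma> {-\<epsilon><..<\<epsilon>} \<and> \<gamma> ` {-\<epsilon><..<\<epsilon>} \<subseteq> N \<and>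
           \<gamma> 0 = p \<and> (\<gamma> has_vector_derivative w) (at 0)}"

(* The derivative within N is not unique as a linear map on the ambient space, but by the chain
   rule along curves in N its values on tangent_space N p are; it is only ever evaluated there. *)
definition differential :: "'a::euclidean_space set \<Rightarrow> ('a \<Rightarrow> real) \<Rightarrow> 'a \<Rightarrow> 'a \<Rightarrow> real" where
  "differential N F p = frechet_derivative F (at p within N)"

definition local_parametrization ::
    "'a::euclidean_space set \<Rightarrow> 'e::euclidean_space set \<Rightarrow> ('e \<Rightarrow> 'a) \<Rightarrow> bool" where
  "local_parametrization N U \<phi> \<longleftrightarrow>
     open U \<and> smooth_on \<phi> U \<and> (\<forall>u\<in>U. inj (frechet_derivative \<phi> (at u))) \<and>
     openin (top_of_set N) (\<phi> ` U) \<and> (\<exists>\<psi>. homeomorphism U (\<phi> ` U) \<phi> \<psi>)"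

(* Measure zero in the manifold N: Lebesgue null in every chart. *)
definition null_in_submanifold ::
    "'e::euclidean_space itself \<Rightarrow> 'a::euclidean_space set \<Rightarrow> 'a set \<Rightarrow> bool" where
  "null_in_submanifold _ N Z \<longleftrightarrow>
     (\<forall>U (\<phi>::'e \<Rightarrow> 'a). local_parametrization N U \<phi> \<longrightarrow> negligible {u\<in>U. \<phi> u \<in> Z})"

definition differentials_independent_at ::
    "'a::euclidean_space set \<Rightarrow> 'i set \<Rightarrow> ('i \<Rightarrow> 'a \<Rightarrow> real) \<Rightarrow> 'a \<Rightarrow> bool" where
  "differentials_independent_at N I F p \<longleftrightarrow>
     (\<forall>c::'i \<Rightarrow> real. (\<forall>w\<in>tangent_space N p. (\<Sum>i\<in>I. c i * differential N (F i) p w) = 0)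
        \<longrightarrow> (\<forall>i\<in>I. c i = 0))"


section \<open>Liouville integrability\<close>

(* The symplectic form is given by its value \<omega> p v w on v, w in tangent_space N p. *)
definition hamiltonian_vector ::
    "'a::euclidean_space set \<Rightarrow> ('a \<Rightarrow> 'a \<Rightarrow> 'a \<Rightarrow> real) \<Rightarrow> ('a \<Rightarrow> real) \<Rightarrow> 'a \<Rightarrow> 'a" where
  "hamiltonian_vector N \<omega> F p =
     (THE X. X \<in> tangent_space N p \<and>
        (\<forall>w\<in>tangent_space N p. \<omega> p X w = differential N F p w))"

definition poisson_bracket ::
    "'a::euclidean_space set \<Rightarrow> ('a \<Rightarrow> 'a \<Rightarrow> 'a \<Rightarrow> real) \<Rightarrow> ('a \<Rightarrow> real) \<Rightarrow> ('a \<Rightarrow> real) \<Rightarrow> 'a \<Rightarrow> real" where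
  "poisson_bracket N \<omega> F G p = \<omega> p (hamiltonian_vector N \<omega> F p) (hamiltonian_vector N \<omega> G p)"

(* Here 'e has dimension 2n = dim N. *)
definition completely_integrable ::
    "'e::euclidean_space itself \<Rightarrow> 'a::euclidean_space set \<Rightarrow> ('a \<Rightarrow> 'a \<Rightarrow> 'a \<Rightarrow> real)
       \<Rightarrow> ('a \<Rightarrow> real) \<Rightarrow> bool" where
  "completely_integrable E N \<omega> H \<longleftrightarrow>
     (\<exists>n (F :: nat \<Rightarrow> 'a \<Rightarrow> real).
        DIM('e) = 2 * n \<and>
        (\<forall>i\<in>{1..n}. smooth_on_submanifold N (F i)) \<and>
        (\<forall>i\<in>{1..n}. \<forall>j\<in>{1..n}. \<forall>p\<in>N. poisson_bracket N \<omega> (F i) (F j) p = 0) \<and>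
        null_in_submanifold E N {p\<in>N. \<not> differentials_independent_at N {1..n} F p} \<and>
        (\<forall>p\<in>N. F n p = H p))"


section \<open>The cotangent bundle of the 7-sphere and the subriemannian Hamiltonians\<close>

definition cotangent_S7 :: "((real^8) \<times> (real^8)) set" where
  "cotangent_S7 = {(q, \<xi>). norm q = 1 \<and> q \<bullet> \<xi> = 0}"

(* Under the identification by the metric the tautological one-form becomes \<theta> = <\<xi>, dq>;
   this is - d\<theta>, the sum of the dq_i \<and> d\<xi>_i, to be evaluated on vectors tangent to cotangent_S7. *)
definition canonical_form ::
    "(real^8) \<times> (real^8) \<Rightarrow> (real^8) \<times> (real^8) \<Rightarrow> (real^8) \<times> (real^8) \<Rightarrow> real" where
  "canonical_form p v w = fst v \<bullet> snd w - snd v \<bullet> fst w"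

definition clifford_family :: "(nat \<Rightarrow> real^8^8) \<Rightarrow> bool" where
  "clifford_family A \<longleftrightarrow>
     (\<forall>i\<in>{1..7}. transpose (A i) = - A i) \<and>
     (\<forall>i\<in>{1..7}. \<forall>j\<in>{1..7}.
        A i ** A j + A j ** A i = (- 2 * (if i = j then 1 else 0)) *\<^sub>R mat 1)"

definition H_sub :: "(nat \<Rightarrow> real^8^8) \<Rightarrow> nat \<Rightarrow> (real^8) \<times> (real^8) \<Rightarrow> real" where
  "H_sub A j = (\<lambda>(q, \<xi>). 1/2 * (\<Sum>i=1..j. ((A i *v q) \<bullet> \<xi>)\<^sup>2))"

definition H_sub_QH :: "(nat \<Rightarrow> real^8^8) \<Rightarrow> (real^8) \<times> (real^8) \<Rightarrow> real" where
  "H_sub_QH A = (\<lambda>(q, \<xi>). 1/2 * (norm \<xi>)\<^sup>2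
     - 1/2 * (((A 6 *v q) \<bullet> \<xi>)\<^sup>2 + ((A 7 *v q) \<bullet> \<xi>)\<^sup>2 + ((A 6 *v (A 7 *v q)) \<bullet> \<xi>)\<^sup>2))"

end

(* Idea. I = A6, J = A7 and K = A6 A7 form a quaternionic structure on R^8, the symmetric involution
   A5 A6 A7 splits R^8 into two blocks of dimension 4, and A2 A3, A2 A4 generate a second quaternionic
   structure that commutes with the first; everything preserves the blocks. The momenta <B q, \<xi>> of
   the skew matrices B obtained by restricting these generators to a block satisfy the bracket
   relations of two pairs of commuting copies of sp(1), and all of them commute with the kinetic energy
   |\<xi>|^2, which is the sum of all <A_i q, \<xi>>^2. Hence the Hamiltonians for D_4, D_5 and D_QH commute
   with the Casimirs of the two blocks, the momenta of A2 A3 on the blocks, the total momentum of K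
   and a Casimir coupling the blocks; for D_6 the last two are replaced by the momenta of J on the
   blocks. Evaluating the differentials on a few well-chosen tangent vectors gives a triangular system
   and shows that they are independent off the zero set of some polynomials. *)
theory Submission
  imports Defs
begin

section \<open>Zero sets of polynomials\<close>

lemma real_polynomial_function_restrict_line:
  fixes f :: "'a::real_normed_vector \<Rightarrow> real"
  assumes "real_polynomial_function f"
  shows "\<exists>d. \<forall>a v. \<exists>p. degree p \<le> d \<and> (\<forall>t. f (a + t *\<^sub>R v) = poly p t)"
  using assms
proof (induction f rule: real_polynomial_function.induct)
  case (linear f)
  then interpret bounded_linear f .
  have "degree [:f a, f v:] \<le> 1 \<and> (\<forall>t. f (a + t *\<^sub>R v) = poly [:f a, f v:] t)" for a v
    by (simp add: add scaleR)
  then show ?case by blast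
next
  case (const c)
  have "degree [:c:] \<le> 0 \<and> (\<forall>t. c = poly [:c:] t)" by simp
  then show ?case by blast
next
  case (add f g)
  then obtain d e where
    d: "\<And>a v. \<exists>p. degree p \<le> d \<and> (\<forall>t. f (a + t *\<^sub>R v) = poly p t)" and
    e: "\<And>a v. \<exists>p. degree p \<le> e \<and> (\<forall>t. g (a + t *\<^sub>R v) = poly p t)"
    by blast
  have "\<exists>p. degree p \<le> max d e \<and> (\<forall>t. f (a + t *\<^sub>R v) + g (a + t *\<^sub>R v) = poly p t)" for a v
  proof -
    obtain p q where "degree p \<le> d" "\<forall>t. f (a + t *\<^sub>R v) = poly p t"
      "degree q \<le> e" "\<forall>t. g (a + t *\<^sub>R v) = poly q t"
      using d e by meson
    then show ?thesis
      by (intro exI[of _ "p + q"]) (auto intro: degree_add_le)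
  qed
  then show ?case by blast
next
  case (mult f g)
  then obtain d e where
    d: "\<And>a v. \<exists>p. degree p \<le> d \<and> (\<forall>t. f (a + t *\<^sub>R v) = poly p t)" and
    e: "\<And>a v. \<exists>p. degree p \<le> e \<and> (\<forall>t. g (a + t *\<^sub>R v) = poly p t)"
    by blast
  have "\<exists>p. degree p \<le> d + e \<and> (\<forall>t. f (a + t *\<^sub>R v) * g (a + t *\<^sub>R v) = poly p t)" for a v
  proof -
    obtain p q where "degree p \<le> d" "\<forall>t. f (a + t *\<^sub>R v) = poly p t"
      "degree q \<le> e" "\<forall>t. g (a + t *\<^sub>R v) = poly q t"
      using d e by meson
    then show ?thesis
      by (intro exI[of _ "p * q"]) (auto intro: order_trans[OF degree_mult_le])
  qed
  then show ?case by blast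
qed

(* Seen from a point where f does not vanish, each ray meets the zero set in at most d points, so
   that m scaled copies of the zero set cover no point more than d times. *)
lemma negligible_zeros_real_polynomial_function:
  fixes f :: "'a::euclidean_space \<Rightarrow> real"
  assumes f: "real_polynomial_function f" and nz: "f a \<noteq> 0"
  shows "negligible {x. f x = 0}"
proof -
  from real_polynomial_function_restrict_line[OF f]
  obtain d where d: "\<forall>a v. \<exists>p. degree p \<le> d \<and> (\<forall>t. f (a + t *\<^sub>R v) = poly p t)"
    by (elim exE)
  define Z where "Z = {x. f (a + x) = 0}"
  have "closed Z"
  proof -
    have "continuous_on UNIV f"
      using f by (blast intro: continuous_at_imp_continuous_on continuous_real_polymonial_function)
    then have "continuous_on UNIV (\<lambda>x. f (a + x))"
      by (rule continuous_on_compose2) (auto intro!: continuous_intros)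
    then show ?thesis
      unfolding Z_def by (intro closed_Collect_eq continuous_on_const)
  qed
  have "negligible (Z \<inter> cball 0 r)" if "r > 0" for r
  proof -
    define C where "C = Z \<inter> cball 0 r"
    define s where "s i = 1 + 1 / real (Suc i)" for i
    define Y where "Y i = (\<lambda>x. s i *\<^sub>R x) ` C" for i
    have "compact C"
      unfolding C_def using \<open>closed Z\<close> by (metis closed_Int_compact compact_cball)
    then have Y_compact: "compact (Y i)" for i
      unfolding Y_def by (rule compact_scaling)
    have s: "1 \<le> s i" "s i \<le> 2" for i
      by (simp_all add: s_def)
    have inj_s: "inj_on (\<lambda>i. 1 / s i) A" for A
    proof (rule inj_onI)
      fix i j assume "1 / s i = 1 / s j"
      with s(1)[of i] s(1)[of j] have "s i = s j" by (simp add: field_simps)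
      then show "i = j" unfolding s_def by (simp add: field_simps)
    qed
    have multiplicity: "(\<Sum>i<m. indicator (Y i) y) \<le> (of_nat d * indicator (cball 0 (2 * r)) y :: ennreal)"
      for m y
    proof (cases "y \<in> cball 0 (2 * r)")
      case False
      have "y \<notin> Y i" for i
      proof
        assume "y \<in> Y i"
        then obtain x where "norm x \<le> r" "y = s i *\<^sub>R x" by (auto simp: Y_def C_def)
        then have "norm y \<le> 2 * r"
          using s[of i] by (simp add: mult_mono)
        with False show False by simp
      qed
      then show ?thesis by simp
    next
      case True
      obtain p where p: "degree p \<le> d" "\<And>t. f (a + t *\<^sub>R y) = poly p t"
        using d[rule_format, of a y] by auto
      have "p \<noteq> 0"
      proof
        assume "p = 0"
        then have "f a = 0" using p(2)[of 0] by simp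
        with nz show False by simp
      qed
      have "(\<lambda>i. 1 / s i) ` {i. i < m \<and> y \<in> Y i} \<subseteq> {t. poly p t = 0}"
      proof clarify
        fix i assume "y \<in> Y i"
        then obtain x where x: "x \<in> Z" "y = s i *\<^sub>R x" by (auto simp: Y_def C_def)
        then have "x = (1 / s i) *\<^sub>R y" using s(1)[of i] by simp
        with x(1) show "poly p (1 / s i) = 0" by (simp add: Z_def p(2)[symmetric])
      qed
      then have "card ((\<lambda>i. 1 / s i) ` {i. i < m \<and> y \<in> Y i}) \<le> degree p"
        using card_poly_roots_bound[OF \<open>p \<noteq> 0\<close>] poly_roots_finite[OF \<open>p \<noteq> 0\<close>]
        by (meson card_mono order_trans)
      then have "card {i. i < m \<and> y \<in> Y i} \<le> d"
        using p(1) by (simp add: card_image inj_s)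
      moreover have "(\<Sum>i<m. indicator (Y i) y) = (of_nat (card {i. i < m \<and> y \<in> Y i}) :: ennreal)"
      proof -
        have "{..<m} \<inter> {i. y \<in> Y i} = {i. i < m \<and> y \<in> Y i}" by auto
        then show ?thesis by (simp add: indicator_def sum.If_cases)
      qed
      ultimately show ?thesis
        using True by simp
    qed
    have bound: "of_nat m * emeasure lebesgue C \<le> of_nat d * emeasure lebesgue (cball (0::'a) (2 * r))" for m
    proof -
      have "emeasure lebesgue C \<le> emeasure lebesgue (Y i)" for i
      proof -
        have "emeasure lebesgue (Y i) = ennreal (\<bar>s i\<bar> ^ DIM('a)) * emeasure lebesgue C"
          using emeasure_lebesgue_affine[of "s i" 0 C] s(1)[of i] by (simp add: Y_def)
        moreover have "1 \<le> ennreal (\<bar>s i\<bar> ^ DIM('a))"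
          using s(1)[of i] by simp
        ultimately show ?thesis
          by (metis mult_1 mult_right_mono zero_le)
      qed
      then have "of_nat m * emeasure lebesgue C \<le> (\<Sum>i<m. emeasure lebesgue (Y i))"
        using sum_mono[of "{..<m}" "\<lambda>_. emeasure lebesgue C" "\<lambda>i. emeasure lebesgue (Y i)"] by simp
      also have "\<dots> = (\<Sum>i<m. \<integral>\<^sup>+y. indicator (Y i) y \<partial>lebesgue)"
        using Y_compact by (intro sum.cong refl nn_integral_indicator[symmetric])
          (simp add: lmeasurable_compact fmeasurableD)
      also have "\<dots> = (\<integral>\<^sup>+y. (\<Sum>i<m. indicator (Y i) y) \<partial>lebesgue)"
        using Y_compact by (subst nn_integral_sum)
          (auto intro!: borel_measurable_indicator simp: lmeasurable_compact fmeasurableD)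
      also have "\<dots> \<le> (\<integral>\<^sup>+y. of_nat d * indicator (cball (0::'a) (2 * r)) y \<partial>lebesgue)"
        by (intro nn_integral_mono multiplicity)
      also have "\<dots> = of_nat d * emeasure lebesgue (cball (0::'a) (2 * r))"
        by (subst nn_integral_cmult_indicator) auto
      finally show ?thesis .
    qed
    have "emeasure lebesgue (cball (0::'a) (2 * r)) < \<infinity>"
      using lmeasurable_cball[of "0::'a" "2 * r"] by (simp add: fmeasurable_def)
    moreover have C_finite: "emeasure lebesgue C < \<infinity>"
      using \<open>compact C\<close> lmeasurable_compact by (auto simp: fmeasurable_def)
    ultimately have "real m * measure lebesgue C \<le> real d * measure lebesgue (cball (0::'a) (2 * r))" for m
      using bound[of m]
      by (simp add: emeasure_eq_ennreal_measure ennreal_of_nat_eq_real_of_nat flip: ennreal_mult)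
    then have "measure lebesgue C \<le> 0"
      by (metis linorder_not_le ex_less_of_nat_mult)
    then have "emeasure lebesgue C = 0"
      using C_finite by (simp add: emeasure_eq_ennreal_measure measure_le_0_iff)
    then show ?thesis
      using \<open>compact C\<close> unfolding C_def[symmetric] negligible_iff_null_sets
      by (simp add: null_sets_def lmeasurable_compact fmeasurableD)
  qed
  then have "negligible (\<Union>n. Z \<inter> cball 0 (real (Suc n)))"
    by (intro negligible_countable_Union) auto
  moreover have "(\<Union>n. Z \<inter> cball 0 (real (Suc n))) = Z"
  proof -
    have "\<exists>n. norm x \<le> real (Suc n)" for x :: 'a
      by (meson less_le_not_le less_Suc_eq of_nat_less_iff order.trans reals_Archimedean2)
    then show ?thesis by auto
  qed
  ultimately have "negligible ((+) a ` Z)"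
    by (simp add: negligible_translation)
  moreover have "{x. f x = 0} = (+) a ` Z"
    by (auto simp: Z_def image_iff intro!: exI[of _ "_ - a"])
  ultimately show ?thesis by simp
qed

lemma real_polynomial_function_inner_linear:
  fixes f g :: "'a::euclidean_space \<Rightarrow> 'b::euclidean_space"
  assumes "linear f" "linear g"
  shows "real_polynomial_function (\<lambda>x. f x \<bullet> g x)"
proof -
  have "bounded_linear (\<lambda>x. f x \<bullet> b)" "bounded_linear (\<lambda>x. g x \<bullet> b)" for b
    using assms linear_conv_bounded_linear
    by (auto intro: bounded_linear_inner_left_comp)
  then have "real_polynomial_function (\<lambda>x. \<Sum>b\<in>Basis. (f x \<bullet> b) * (g x \<bullet> b))"
    by (intro real_polynomial_function_sum real_polynomial_function.intros) auto
  then show ?thesis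
    by (simp flip: euclidean_inner)
qed

section \<open>Smooth maps\<close>

lemma Ck_on_Suc_imp: "Ck_on (Suc k) f S \<Longrightarrow> Ck_on k f S"
proof (induction k arbitrary: f)
  case 0
  then have "\<forall>x\<in>S. f differentiable at x" by simp
  then show ?case
    by (auto intro!: continuous_at_imp_continuous_on differentiable_imp_continuous_within)
next
  case (Suc k)
  then show ?case by simp
qed

lemma smooth_on_subset: "smooth_on f S \<Longrightarrow> T \<subseteq> S \<Longrightarrow> smooth_on f T"
proof -
  have "Ck_on k f T" if "Ck_on k f S" "T \<subseteq> S" for k
    using that by (induction k arbitrary: f) (auto intro: continuous_on_subset)
  then show "smooth_on f S \<Longrightarrow> T \<subseteq> S \<Longrightarrow> smooth_on f T"
    by (auto simp: smooth_on_def)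
qed

lemma Ck_on_const: "Ck_on k (\<lambda>_. c) S"
  by (induction k arbitrary: c) (auto intro!: continuous_intros)

lemma smooth_on_const: "smooth_on (\<lambda>_. c) S"
  by (simp add: smooth_on_def Ck_on_const)

lemma smooth_on_bounded_linear:
  assumes "bounded_linear f"
  shows "smooth_on f S"
proof -
  have "frechet_derivative f (at x) = f" for x
    using assms bounded_linear_imp_has_derivative frechet_derivative_at by metis
  moreover have "f differentiable at x" for x
    using assms bounded_linear_imp_differentiable by blast
  ultimately have "Ck_on k f S" for k
    using assms by (cases k) (auto simp: Ck_on_const linear_continuous_on)
  then show ?thesis by (simp add: smooth_on_def)
qed

lemma Ck_on_add:
  "Ck_on k f UNIV \<Longrightarrow> Ck_on k g UNIV \<Longrightarrow> Ck_on k (\<lambda>x. f x + g x) UNIV"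
proof (induction k arbitrary: f g)
  case 0
  then show ?case by (auto intro: continuous_intros)
next
  case (Suc k)
  then have "f differentiable at x" "g differentiable at x" for x by auto
  then have der: "((\<lambda>x. f x + g x) has_derivative
      (\<lambda>v. frechet_derivative f (at x) v + frechet_derivative g (at x) v)) (at x)" for x
    by (intro has_derivative_add) (simp_all flip: frechet_derivative_works)
  then have "frechet_derivative (\<lambda>x. f x + g x) (at x) =
      (\<lambda>v. frechet_derivative f (at x) v + frechet_derivative g (at x) v)" for x
    by (metis frechet_derivative_at)
  with Suc der show ?case by (auto intro!: differentiableI)
qed

lemma (in bounded_bilinear) Ck_on_prod:
  "Ck_on k f UNIV \<Longrightarrow> Ck_on k g UNIV \<Longrightarrow> Ck_on k (\<lambda>x. prod (f x) (g x)) UNIV"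
proof (induction k arbitrary: f g)
  case 0
  then show ?case by (auto intro: continuous_on)
next
  case (Suc k)
  then have diff: "f differentiable at x" "g differentiable at x" for x by auto
  then have der: "((\<lambda>x. prod (f x) (g x)) has_derivative
     (\<lambda>v. prod (f x) (frechet_derivative g (at x) v) + prod (frechet_derivative f (at x) v) (g x))) (at x)" for x
    by (intro FDERIV) (simp_all flip: frechet_derivative_works)
  then have "frechet_derivative (\<lambda>x. prod (f x) (g x)) (at x) =
     (\<lambda>v. prod (f x) (frechet_derivative g (at x) v) + prod (frechet_derivative f (at x) v) (g x))" for x
    by (metis frechet_derivative_at)
  moreover have "Ck_on k f UNIV" "Ck_on k g UNIV"
    using Suc.prems by (auto intro: Ck_on_Suc_imp simp del: Ck_on.simps)
  ultimately show ?case
    using Suc der by (auto intro!: Ck_on_add differentiableI)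
qed

lemma smooth_on_add: "smooth_on f UNIV \<Longrightarrow> smooth_on g UNIV \<Longrightarrow> smooth_on (\<lambda>x. f x + g x) UNIV"
  by (simp add: smooth_on_def Ck_on_add)

lemma (in bounded_bilinear) smooth_on_prod:
  "smooth_on f UNIV \<Longrightarrow> smooth_on g UNIV \<Longrightarrow> smooth_on (\<lambda>x. prod (f x) (g x)) UNIV"
  by (simp add: smooth_on_def Ck_on_prod)

lemmas smooth_on_mult = bounded_bilinear.smooth_on_prod[OF bounded_bilinear_mult]
lemmas smooth_on_scaleR = bounded_bilinear.smooth_on_prod[OF bounded_bilinear_scaleR]
lemmas smooth_on_inner = bounded_bilinear.smooth_on_prod[OF bounded_bilinear_inner]

lemma smooth_on_minus:
  assumes "smooth_on f UNIV" shows "smooth_on (\<lambda>x. - f x) UNIV"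
  using smooth_on_scaleR[OF smooth_on_const[of "-1"] assms] by simp

lemma smooth_on_diff:
  assumes "smooth_on f UNIV" "smooth_on g UNIV" shows "smooth_on (\<lambda>x. f x - g x) UNIV"
  using smooth_on_add[OF assms(1) smooth_on_minus[OF assms(2)]] by simp

lemma smooth_on_power2:
  fixes f :: "_ \<Rightarrow> real"
  assumes "smooth_on f UNIV" shows "smooth_on (\<lambda>x. (f x)\<^sup>2) UNIV"
  using smooth_on_mult[OF assms assms] by (simp add: power2_eq_square)

lemma smooth_on_sin_cos:
  "smooth_on (\<lambda>t::real. sin (c * t)) UNIV" "smooth_on (\<lambda>t::real. cos (c * t)) UNIV"
proof -
  have s: "((\<lambda>t. sin (c * t)) has_derivative (\<lambda>v. (v * c) * cos (c * x))) (at x)"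
    and c: "((\<lambda>t. cos (c * t)) has_derivative (\<lambda>v. (- v * c) * sin (c * x))) (at x)" for x
    by (auto intro!: derivative_eq_intros ext simp: algebra_simps)
  have "frechet_derivative (\<lambda>t. sin (c * t)) (at x) = (\<lambda>v. (v * c) * cos (c * x))"
    "frechet_derivative (\<lambda>t. cos (c * t)) (at x) = (\<lambda>v. (- v * c) * sin (c * x))" for x
    using s c by (metis frechet_derivative_at)+
  moreover have "(\<lambda>t. sin (c * t)) differentiable at x" "(\<lambda>t. cos (c * t)) differentiable at x" for x
    by (rule differentiableI[OF s], rule differentiableI[OF c])
  ultimately have *: "Ck_on (Suc k) (\<lambda>t. sin (c * t)) UNIV \<longleftrightarrow> (\<forall>v. Ck_on k (\<lambda>t. (v * c) * cos (c * t)) UNIV)"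
    "Ck_on (Suc k) (\<lambda>t. cos (c * t)) UNIV \<longleftrightarrow> (\<forall>v. Ck_on k (\<lambda>t. (- v * c) * sin (c * t)) UNIV)" for k
    by simp_all
  have mult: "Ck_on k (\<lambda>t. r * g t) UNIV" if "Ck_on k g UNIV" for k r and g :: "real \<Rightarrow> real"
    by (rule bounded_bilinear.Ck_on_prod[OF bounded_bilinear_mult Ck_on_const that])
  have "Ck_on k (\<lambda>t. sin (c * t)) UNIV \<and> Ck_on k (\<lambda>t. cos (c * t)) UNIV" for k
  proof (induction k)
    case 0
    show ?case by (auto intro!: continuous_intros)
  next
    case (Suc k)
    then show ?case unfolding * by (metis mult)
  qed
  then show "smooth_on (\<lambda>t::real. sin (c * t)) UNIV" "smooth_on (\<lambda>t::real. cos (c * t)) UNIV"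
    by (auto simp: smooth_on_def)
qed

lemma smooth_on_Pair:
  assumes "smooth_on f UNIV" "smooth_on g UNIV"
  shows "smooth_on (\<lambda>x. (f x, g x)) UNIV"
proof -
  have "Ck_on k (\<lambda>x. (f x, g x)) UNIV" if "Ck_on k f UNIV" "Ck_on k g UNIV" for k
    using that
  proof (induction k arbitrary: f g)
    case 0
    then show ?case by (auto intro: continuous_intros)
  next
    case (Suc k)
    then have "f differentiable at x" "g differentiable at x" for x by auto
    then have der: "((\<lambda>x. (f x, g x)) has_derivative
       (\<lambda>v. (frechet_derivative f (at x) v, frechet_derivative g (at x) v))) (at x)" for x
      by (intro has_derivative_Pair) (simp_all flip: frechet_derivative_works)
    then have "frechet_derivative (\<lambda>x. (f x, g x)) (at x) =
       (\<lambda>v. (frechet_derivative f (at x) v, frechet_derivative g (at x) v))" for x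
      by (metis frechet_derivative_at)
    then show ?case using Suc der by (auto intro!: differentiableI)
  qed
  with assms show ?thesis by (auto simp: smooth_on_def)
qed

lemma smooth_on_has_derivative:
  "smooth_on f S \<Longrightarrow> x \<in> S \<Longrightarrow> (f has_derivative frechet_derivative f (at x)) (at x)"
  unfolding smooth_on_def by (metis Ck_on.simps(2) frechet_derivative_works)

section \<open>Derivatives within a submanifold\<close>

lemma differential_eq:
  assumes F: "(F has_derivative F') (at p)" and w: "w \<in> tangent_space N p"
  shows "differential N F p w = F' w"
proof -
  obtain \<gamma> \<epsilon> where \<gamma>: "\<epsilon> > 0" "\<gamma> ` {-\<epsilon><..<\<epsilon>} \<subseteq> N" "\<gamma> 0 = p" "(\<gamma> has_vector_derivative w) (at 0)"
    using w by (auto simp: tangent_space_def)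
  let ?S = "{-\<epsilon><..<\<epsilon>}"
  have N: "(F has_derivative frechet_derivative F (at p within N)) (at p within N)"
    using F by (metis differentiableI differentiable_at_withinI frechet_derivative_works)
  have \<gamma>': "(\<gamma> has_derivative (\<lambda>t. t *\<^sub>R w)) (at 0 within ?S)"
    using \<gamma>(4) by (simp add: has_vector_derivative_def has_derivative_at_withinI)
  have "(F has_derivative F') (at (\<gamma> 0) within \<gamma> ` ?S)"
    using F \<gamma>(3) by (simp add: has_derivative_at_withinI)
  then have "(F \<circ> \<gamma> has_derivative F' \<circ> (\<lambda>t. t *\<^sub>R w)) (at 0 within ?S)"
    by (rule diff_chain_within[OF \<gamma>'])
  moreover have "(F has_derivative frechet_derivative F (at p within N)) (at (\<gamma> 0) within \<gamma> ` ?S)"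
    using has_derivative_subset[OF N \<gamma>(2)] \<gamma>(3) by simp
  then have "(F \<circ> \<gamma> has_derivative frechet_derivative F (at p within N) \<circ> (\<lambda>t. t *\<^sub>R w)) (at 0 within ?S)"
    by (rule diff_chain_within[OF \<gamma>'])
  moreover have "at 0 within ?S = at 0"
    using \<gamma>(1) by (intro at_within_open) auto
  ultimately have "F' \<circ> (\<lambda>t. t *\<^sub>R w) = frechet_derivative F (at p within N) \<circ> (\<lambda>t. t *\<^sub>R w)"
    by (metis has_derivative_unique)
  from fun_cong[OF this, of 1] show ?thesis
    by (simp add: differential_def)
qed

section \<open>The cotangent bundle of the sphere\<close>

lemma mem_cotangent_S7: "p \<in> cotangent_S7 \<longleftrightarrow> norm (fst p) = 1 \<and> fst p \<bullet> snd p = 0"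
  by (cases p) (simp add: cotangent_S7_def)

lemma derivative_into_cotangent_S7:
  assumes \<phi>: "(\<phi> has_derivative d) (at u)" and U: "open U" "u \<in> U" "\<phi> ` U \<subseteq> cotangent_S7"
  shows "fst (\<phi> u) \<bullet> fst (d h) = 0" "fst (d h) \<bullet> snd (\<phi> u) + fst (\<phi> u) \<bullet> snd (d h) = 0"
proof -
  have const: "g' = (\<lambda>_. 0)"
    if "((\<lambda>v. g (\<phi> v)) has_derivative g') (at u)" "\<And>x. x \<in> cotangent_S7 \<Longrightarrow> g x = (c::real)" for g g' c
  proof -
    have "((\<lambda>v. g (\<phi> v)) has_derivative (\<lambda>_. 0)) (at u)"
    proof (rule has_derivative_transform_within_open[OF has_derivative_const[of c] U(1,2)])
      fix v assume "v \<in> U"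
      then have "\<phi> v \<in> cotangent_S7" using U(3) by blast
      then show "c = g (\<phi> v)" by (rule that(2)[symmetric])
    qed
    then show ?thesis using that(1) has_derivative_unique by blast
  qed
  have "((\<lambda>v. fst (\<phi> v) \<bullet> fst (\<phi> v)) has_derivative (\<lambda>h. 2 * (fst (\<phi> u) \<bullet> fst (d h)))) (at u)"
    by (rule derivative_eq_intros \<phi> refl | simp add: inner_commute)+
  then have "(\<lambda>h. 2 * (fst (\<phi> u) \<bullet> fst (d h))) = (\<lambda>_. 0)"
    by (rule const[where c=1]) (simp add: mem_cotangent_S7 dot_square_norm)
  then show "fst (\<phi> u) \<bullet> fst (d h) = 0" by (drule_tac fun_cong[of _ _ h]) simp
  have "((\<lambda>v. fst (\<phi> v) \<bullet> snd (\<phi> v)) has_derivative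
      (\<lambda>h. fst (d h) \<bullet> snd (\<phi> u) + fst (\<phi> u) \<bullet> snd (d h))) (at u)"
    by (rule derivative_eq_intros \<phi> refl | simp add: algebra_simps)+
  then have "(\<lambda>h. fst (d h) \<bullet> snd (\<phi> u) + fst (\<phi> u) \<bullet> snd (d h)) = (\<lambda>_. 0)"
    by (rule const[where c=0]) (simp add: mem_cotangent_S7)
  then show "fst (d h) \<bullet> snd (\<phi> u) + fst (\<phi> u) \<bullet> snd (d h) = 0" by (drule_tac fun_cong[of _ _ h]) simp
qed

lemma tangent_space_cotangent_S7:
  assumes p: "p \<in> cotangent_S7"
  shows "tangent_space cotangent_S7 p =
    {w. fst p \<bullet> fst w = 0 \<and> fst w \<bullet> snd p + fst p \<bullet> snd w = 0}"
proof (intro equalityI subsetI)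
  fix w assume "w \<in> tangent_space cotangent_S7 p"
  then obtain \<gamma> \<epsilon> where \<gamma>: "\<epsilon> > 0" "\<gamma> ` {-\<epsilon><..<\<epsilon>} \<subseteq> cotangent_S7" "\<gamma> 0 = p"
    and "(\<gamma> has_vector_derivative w) (at 0)"
    by (auto simp: tangent_space_def)
  then have \<gamma>': "(\<gamma> has_derivative (\<lambda>t. t *\<^sub>R w)) (at 0)"
    by (simp add: has_vector_derivative_def)
  from derivative_into_cotangent_S7[OF \<gamma>' _ _ \<gamma>(2), of 1] \<gamma>(1,3)
  show "w \<in> {w. fst p \<bullet> fst w = 0 \<and> fst w \<bullet> snd p + fst p \<bullet> snd w = 0}" by simp
next
  fix w assume w: "w \<in> {w. fst p \<bullet> fst w = 0 \<and> fst w \<bullet> snd p + fst p \<bullet> snd w = 0}"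
  define q \<xi> a b where defs: "q = fst p" "\<xi> = snd p" "a = fst w" "b = snd w"
  have q: "norm q = 1" "q \<bullet> \<xi> = 0" "q \<bullet> a = 0" "a \<bullet> \<xi> + q \<bullet> b = 0"
    using p w by (auto simp: defs mem_cotangent_S7)
  define c where "c = norm a"
  (* The base point runs along a great circle and the fibre point is projected back to the fibre. *)
  define x where "x t = cos (c * t) *\<^sub>R q + (sin (c * t) / c) *\<^sub>R a" for t
  define l where "l t = x t \<bullet> (\<xi> + t *\<^sub>R b)" for t
  define \<gamma> where "\<gamma> t = (x t, (\<xi> + t *\<^sub>R b) - l t *\<^sub>R x t)" for t
  have norm_x: "x t \<bullet> x t = 1" for t
  proof -
    have "x t \<bullet> x t = (cos (c * t))\<^sup>2 + (sin (c * t) / c)\<^sup>2 * c\<^sup>2"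
    proof -
      have "q \<bullet> q = 1" "a \<bullet> a = c\<^sup>2" "a \<bullet> q = 0"
        using q by (simp_all add: c_def power2_norm_eq_inner inner_commute norm_eq_1)
      then show ?thesis
        using q by (simp add: x_def inner_simps power2_eq_square)
    qed
    then show ?thesis
      using q(1) by (cases "c = 0") (simp_all add: power_divide)
  qed
  have "\<gamma> t \<in> cotangent_S7" for t
  proof -
    have "norm (x t) = 1" using norm_x[of t] by (simp add: norm_eq_1)
    moreover have "x t \<bullet> (\<xi> + t *\<^sub>R b - l t *\<^sub>R x t) = 0"
      by (simp add: inner_diff_right norm_x l_def)
    ultimately show ?thesis by (simp add: mem_cotangent_S7 \<gamma>_def)
  qed
  moreover have "\<gamma> 0 = p"
    using q by (simp add: \<gamma>_def x_def l_def) (simp add: defs)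
  moreover have "(\<gamma> has_vector_derivative w) (at 0)"
  proof -
    have x': "(x has_vector_derivative a) (at 0)"
    proof -
      have "((\<lambda>t. cos (c * t)) has_real_derivative 0) (at 0)"
        by (auto intro!: derivative_eq_intros)
      moreover have "((\<lambda>t. sin (c * t) / c) has_real_derivative c / c) (at 0)"
        by (cases "c = 0") (auto intro!: derivative_eq_intros)
      ultimately have "((\<lambda>t. cos (c * t) *\<^sub>R q + (sin (c * t) / c) *\<^sub>R a) has_vector_derivative
          ((cos (c * 0) *\<^sub>R 0 + 0 *\<^sub>R q) + ((sin (c * 0) / c) *\<^sub>R 0 + (c / c) *\<^sub>R a))) (at 0)"
        by (intro has_vector_derivative_add has_vector_derivative_scaleR has_vector_derivative_const)
          (auto simp: has_real_derivative_iff_has_vector_derivative)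
      moreover have "(c / c) *\<^sub>R a = a"
        by (cases "c = 0") (auto simp: c_def)
      ultimately show ?thesis by (simp add: x_def[abs_def])
    qed
    have y': "((\<lambda>t. \<xi> + t *\<^sub>R b) has_vector_derivative b) (at 0)"
      by (auto intro!: derivative_eq_intros)
    have "((\<lambda>t. x t \<bullet> (\<xi> + t *\<^sub>R b)) has_vector_derivative (x 0 \<bullet> b + a \<bullet> (\<xi> + 0 *\<^sub>R b))) (at 0)"
      by (rule bounded_bilinear.has_vector_derivative[OF bounded_bilinear_inner x' y'])
    then have "(l has_vector_derivative 0) (at 0)"
      using q by (simp add: l_def[abs_def] x_def add.commute)
    then have "((\<lambda>t. (\<xi> + t *\<^sub>R b) - l t *\<^sub>R x t) has_vector_derivative b - (l 0 *\<^sub>R a + 0 *\<^sub>R x 0)) (at 0)"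
      by (intro has_vector_derivative_diff y' has_vector_derivative_scaleR x')
        (simp add: has_real_derivative_iff_has_vector_derivative)
    moreover have "l 0 = 0" using q by (simp add: l_def x_def)
    ultimately have "((\<lambda>t. (\<xi> + t *\<^sub>R b) - l t *\<^sub>R x t) has_vector_derivative b) (at 0)" by simp
    from has_vector_derivative_Pair[OF x' this] show ?thesis
      by (simp add: \<gamma>_def[abs_def] defs)
  qed
  moreover have "smooth_on \<gamma> UNIV"
  proof -
    have "smooth_on (\<lambda>t. (1 / c) * sin (c * t)) UNIV"
      by (intro smooth_on_mult smooth_on_const smooth_on_sin_cos)
    then have "smooth_on (\<lambda>t. sin (c * t) / c) UNIV" by simp
    then have x: "smooth_on x UNIV"
      unfolding x_def[abs_def]
      by (intro smooth_on_add smooth_on_scaleR smooth_on_const smooth_on_sin_cos)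
    have y: "smooth_on (\<lambda>t. \<xi> + t *\<^sub>R b) UNIV"
      by (intro smooth_on_add smooth_on_scaleR smooth_on_const smooth_on_bounded_linear bounded_linear_ident)
    show ?thesis
      unfolding \<gamma>_def[abs_def] l_def
      by (rule smooth_on_Pair[OF x smooth_on_diff[OF y smooth_on_scaleR[OF smooth_on_inner[OF x y] x]]])
  qed
  ultimately show "w \<in> tangent_space cotangent_S7 p"
    unfolding tangent_space_def
    by (intro CollectI exI[of _ \<gamma>] exI[of _ 1]) (auto intro: smooth_on_subset)
qed

lemma canonical_form_linear:
  "canonical_form p (v + v') w = canonical_form p v w + canonical_form p v' w"
  "canonical_form p (v - v') w = canonical_form p v w - canonical_form p v' w"
  "canonical_form p (r *\<^sub>R v) w = r * canonical_form p v w"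
  "canonical_form p v (w + w') = canonical_form p v w + canonical_form p v w'"
  "canonical_form p v (w - w') = canonical_form p v w - canonical_form p v w'"
  "canonical_form p v (r *\<^sub>R w) = r * canonical_form p v w"
  "canonical_form p 0 w = 0"
  "canonical_form p v 0 = 0"
  by (simp_all add: canonical_form_def inner_simps algebra_simps)

lemma canonical_form_nondegenerate:
  assumes p: "p \<in> cotangent_S7" and X: "X \<in> tangent_space cotangent_S7 p"
    and 0: "\<And>w. w \<in> tangent_space cotangent_S7 p \<Longrightarrow> canonical_form p X w = 0"
  shows "X = 0"
proof -
  have qq: "fst p \<bullet> fst p = 1" "fst p \<bullet> snd p = 0"
    using p by (simp_all add: mem_cotangent_S7 norm_eq_1)
  have X': "fst p \<bullet> fst X = 0" "fst X \<bullet> snd p + fst p \<bullet> snd X = 0"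
    using X p by (simp_all add: tangent_space_cotangent_S7)
  have "(0, fst X) \<in> tangent_space cotangent_S7 p"
    using p X' by (simp add: tangent_space_cotangent_S7)
  from 0[OF this] have fst0: "fst X = 0"
    by (simp add: canonical_form_def)
  have "(snd X, - (snd X \<bullet> snd p) *\<^sub>R fst p) \<in> tangent_space cotangent_S7 p"
    using p X' qq fst0 by (simp add: tangent_space_cotangent_S7)
  from 0[OF this] have "snd X = 0"
    using fst0 by (simp add: canonical_form_def)
  with fst0 show ?thesis by (simp add: prod_eq_iff)
qed

lemma tangent_space_diff:
  "p \<in> cotangent_S7 \<Longrightarrow> X \<in> tangent_space cotangent_S7 p \<Longrightarrow> Y \<in> tangent_space cotangent_S7 p \<Longrightarrow>
    X - Y \<in> tangent_space cotangent_S7 p"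
  by (simp add: tangent_space_cotangent_S7 inner_simps)

lemma hamiltonian_vector_eq:
  assumes p: "p \<in> cotangent_S7" and F: "(F has_derivative canonical_form p X) (at p)"
    and X: "X \<in> tangent_space cotangent_S7 p"
  shows "hamiltonian_vector cotangent_S7 canonical_form F p = X"
  unfolding hamiltonian_vector_def
proof (rule the_equality)
  show "X \<in> tangent_space cotangent_S7 p \<and>
      (\<forall>w\<in>tangent_space cotangent_S7 p. canonical_form p X w = differential cotangent_S7 F p w)"
    using X differential_eq[OF F] by simp
next
  fix Y assume Y: "Y \<in> tangent_space cotangent_S7 p \<and>
      (\<forall>w\<in>tangent_space cotangent_S7 p. canonical_form p Y w = differential cotangent_S7 F p w)"
  have "Y - X = 0"
    using Y differential_eq[OF F]
    by (intro canonical_form_nondegenerate[OF p] tangent_space_diff[OF p] X)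
      (auto simp: canonical_form_linear)
  then show "Y = X" by simp
qed

(* The map (u, r, s) \<mapsto> (r q, \<xi> + s q), where (q, \<xi>) = \<phi> u, extends a chart of the cotangent bundle
   to a diffeomorphism onto an open subset of the ambient space. *)
lemma null_in_cotangent_S7:
  fixes f :: "(real^8) \<times> (real^8) \<Rightarrow> real"
  assumes dim: "DIM('e::euclidean_space) = 14"
    and f: "real_polynomial_function f" "f a \<noteq> 0"
    and inv: "\<And>q \<xi> r s. f (q, \<xi>) = 0 \<Longrightarrow> f (r *\<^sub>R q, \<xi> + s *\<^sub>R q) = 0"
  shows "null_in_submanifold TYPE('e) cotangent_S7 {p\<in>cotangent_S7. f p = 0}"
  unfolding null_in_submanifold_def
proof (intro allI impI)
  fix U and \<phi> :: "'e \<Rightarrow> (real^8) \<times> (real^8)"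
  assume "local_parametrization cotangent_S7 U \<phi>"
  then obtain \<psi> where U: "open U" and smooth: "smooth_on \<phi> U"
    and inj: "\<And>u. u \<in> U \<Longrightarrow> inj (frechet_derivative \<phi> (at u))"
    and im: "openin (top_of_set cotangent_S7) (\<phi> ` U)" and hom: "homeomorphism U (\<phi> ` U) \<phi> \<psi>"
    by (auto simp: local_parametrization_def)
  have der: "(\<phi> has_derivative frechet_derivative \<phi> (at u)) (at u)" if "u \<in> U" for u
    using smooth that by (rule smooth_on_has_derivative)
  have \<phi>_in: "\<phi> u \<in> cotangent_S7" if "u \<in> U" for u
    using im that openin_imp_subset by blast
  have \<psi>: "\<psi> (\<phi> u) = u" if "u \<in> U" for u
    using hom that by (simp add: homeomorphism_def)
  have \<psi>_cont: "continuous_on (\<phi> ` U) \<psi>"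
    using hom by (simp add: homeomorphism_def)
  define \<Phi> where "\<Phi> = (\<lambda>(u, r::real, s::real). (r *\<^sub>R fst (\<phi> u), snd (\<phi> u) + s *\<^sub>R fst (\<phi> u)))"
  define sc where "sc p = (fst p \<bullet> snd p) / norm (fst p)" for p :: "(real^8) \<times> (real^8)"
  define \<rho> where "\<rho> p = (fst p /\<^sub>R norm (fst p), snd p - (sc p / norm (fst p)) *\<^sub>R fst p)" for p
  define g where "g p = (\<psi> (\<rho> p), norm (fst p), sc p)" for p
  define R where "R = {p :: (real^8) \<times> (real^8). fst p \<noteq> 0}"
  define D where "D = R \<inter> \<rho> -` (\<phi> ` U)"
  have sq: "x \<bullet> x = norm x * norm x" for x :: "real^8"
    by (simp add: dot_square_norm power2_eq_square)
  have \<rho>_in: "\<rho> p \<in> cotangent_S7" if "p \<in> R" for p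
    using that by (simp add: \<rho>_def mem_cotangent_S7 R_def sc_def inner_simps sq field_simps)
  have \<rho>_cont: "continuous_on R \<rho>" and sc_cont: "continuous_on R sc"
    unfolding \<rho>_def sc_def by (auto intro!: continuous_intros simp: R_def)
  have "open R"
    unfolding R_def by (intro open_Collect_neq continuous_intros)
  have "openin (top_of_set R) D"
    unfolding D_def using \<rho>_cont im \<rho>_in by (intro continuous_openin_preimage) auto
  then have "open D" using \<open>open R\<close> openin_open_trans by blast
  have g_cont: "continuous_on D g"
    unfolding g_def
    by (intro continuous_intros continuous_on_compose2[OF \<psi>_cont] continuous_on_subset[OF \<rho>_cont]
        continuous_on_subset[OF sc_cont]) (auto simp: D_def)
  have \<Phi>_g: "\<Phi> (g p) = p" if "p \<in> D" for p
  proof -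
    obtain u where u: "u \<in> U" "\<rho> p = \<phi> u" "fst p \<noteq> 0"
      using \<open>p \<in> D\<close> by (auto simp: D_def R_def)
    then have "\<Phi> (g p) = (norm (fst p) *\<^sub>R fst (\<rho> p), snd (\<rho> p) + sc p *\<^sub>R fst (\<rho> p))"
      by (simp add: g_def \<Phi>_def \<psi>)
    also have "\<dots> = p"
      using u(3) by (simp add: \<rho>_def prod_eq_iff divide_inverse)
    finally show ?thesis .
  qed
  have g_\<Phi>: "g (\<Phi> (u, r, s)) = (u, r, s)" and \<Phi>_D: "\<Phi> (u, r, s) \<in> D" if "u \<in> U" "r > 0" for u r s
  proof -
    have *: "norm (fst (\<phi> u)) = 1" "fst (\<phi> u) \<bullet> fst (\<phi> u) = 1" "fst (\<phi> u) \<bullet> snd (\<phi> u) = 0"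
      using \<phi>_in[OF \<open>u \<in> U\<close>] by (auto simp: mem_cotangent_S7 norm_eq_1)
    have "sc (\<Phi> (u, r, s)) = s" "norm (fst (\<Phi> (u, r, s))) = r"
      using * \<open>r > 0\<close> by (auto simp: \<Phi>_def sc_def inner_simps)
    then have "\<rho> (\<Phi> (u, r, s)) = \<phi> u" "norm (fst (\<Phi> (u, r, s))) = r" "sc (\<Phi> (u, r, s)) = s"
      using * \<open>r > 0\<close> by (auto simp: \<rho>_def \<Phi>_def prod_eq_iff)
    then show "g (\<Phi> (u, r, s)) = (u, r, s)" "\<Phi> (u, r, s) \<in> D"
      using that by (auto simp: g_def \<psi> D_def R_def)
  qed
  have "g differentiable at p" if "p \<in> D" for p
  proof -
    obtain u where u: "u \<in> U" "\<rho> p = \<phi> u" "fst p \<noteq> 0"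
      using \<open>p \<in> D\<close> by (auto simp: D_def R_def)
    define r s where "r = norm (fst p)" "s = sc p"
    have gp: "g p = (u, r, s)" and "r > 0"
      using u by (auto simp: g_def \<psi> r_s_def)
    define d where "d = frechet_derivative \<phi> (at u)"
    have d: "(\<phi> has_derivative d) (at (fst (u, r, s)))"
      using der[OF u(1)] by (simp add: d_def)
    define \<Phi>' where "\<Phi>' h = (r *\<^sub>R fst (d (fst h)) + fst (snd h) *\<^sub>R fst (\<phi> u),
        snd (d (fst h)) + (s *\<^sub>R fst (d (fst h)) + snd (snd h) *\<^sub>R fst (\<phi> u)))" for h
    have comp: "((\<lambda>h. \<phi> (fst h)) has_derivative (\<lambda>h. d (fst h))) (at (u, r, s))"
      using has_derivative_compose[OF has_derivative_fst[OF has_derivative_ident] d] .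
    have "((\<lambda>h. (fst (snd h) *\<^sub>R fst (\<phi> (fst h)), snd (\<phi> (fst h)) + snd (snd h) *\<^sub>R fst (\<phi> (fst h))))
        has_derivative \<Phi>') (at (u, r, s))"
      unfolding \<Phi>'_def[abs_def]
      by (rule derivative_eq_intros comp refl | simp)+
    then have der\<Phi>: "(\<Phi> has_derivative \<Phi>') (at (g p))"
      unfolding gp by (simp add: \<Phi>_def case_prod_unfold)
    have "inj \<Phi>'"
    proof -
      interpret linear \<Phi>'
        using der\<Phi> has_derivative_linear by blast
      have lin_d: "linear d"
        using d has_derivative_linear by blast
      have "h = 0" if "\<Phi>' h = 0" for h
      proof -
        have t: "fst (\<phi> u) \<bullet> fst (d (fst h)) = 0"
          "fst (d (fst h)) \<bullet> snd (\<phi> u) + fst (\<phi> u) \<bullet> snd (d (fst h)) = 0"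
          using derivative_into_cotangent_S7[OF d, of U "fst h"] U u(1) \<phi>_in by auto
        have q: "fst (\<phi> u) \<bullet> fst (\<phi> u) = 1" "fst (\<phi> u) \<noteq> 0"
          using \<phi>_in[OF u(1)] by (auto simp: mem_cotangent_S7 norm_eq_1)
        have 1: "r *\<^sub>R fst (d (fst h)) + fst (snd h) *\<^sub>R fst (\<phi> u) = 0"
          and 2: "snd (d (fst h)) + (s *\<^sub>R fst (d (fst h)) + snd (snd h) *\<^sub>R fst (\<phi> u)) = 0"
          using that by (simp_all add: \<Phi>'_def prod_eq_iff)
        from arg_cong[OF 1, of "inner (fst (\<phi> u))"] have "fst (snd h) = 0"
          using t q by (simp add: inner_simps)
        with 1 \<open>r > 0\<close> have d0: "fst (d (fst h)) = 0" by simp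
        from arg_cong[OF 2, of "inner (fst (\<phi> u))"] have "snd (snd h) = 0"
          using t q d0 by (simp add: inner_simps)
        with 2 d0 have "d (fst h) = 0" by (simp add: prod_eq_iff)
        then have "fst h = 0"
          using inj[OF u(1)] linear_injective_0[OF lin_d] by (simp add: d_def)
        with \<open>fst (snd h) = 0\<close> \<open>snd (snd h) = 0\<close> show "h = 0" by (simp add: prod_eq_iff)
      qed
      then show ?thesis
        using linear_injective_0[OF linear_axioms] by blast
    qed
    then obtain g' where g': "linear g'" "g' \<circ> \<Phi>' = id"
      using linear_injective_left_inverse[of \<Phi>'] has_derivative_linear[OF der\<Phi>] by blast
    have "(g has_derivative g') (at p)"
      using \<open>open D\<close> \<open>p \<in> D\<close> g_cont g' \<Phi>_g der\<Phi>
      by (intro has_derivative_inverse_basic[where f=\<Phi> and f'=\<Phi>' and T=D])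
        (auto simp: linear_conv_bounded_linear continuous_on_eq_continuous_at)
    then show ?thesis by (rule differentiableI)
  qed
  then have "g differentiable_on (D \<inter> {p. f p = 0})"
    by (intro differentiable_at_imp_differentiable_on) (simp add: Int_iff)
  moreover have "negligible (D \<inter> {p. f p = 0})"
    by (rule negligible_subset[OF negligible_zeros_real_polynomial_function[OF f] Int_lower2])
  ultimately have neg: "negligible (g ` (D \<inter> {p. f p = 0}))"
    by (intro negligible_differentiable_image_negligible) (simp_all add: dim)
  define T where "T = {u\<in>U. f (\<phi> u) = 0}"
  have "T \<times> cbox (1, 0) (2 :: real, 1 :: real) \<subseteq> g ` (D \<inter> {p. f p = 0})"
  proof
    fix z assume "z \<in> T \<times> cbox (1, 0) (2 :: real, 1 :: real)"
    then obtain u r s where z: "z = (u, r, s)" and u: "u \<in> U" "r > 0" "f (\<phi> u) = 0"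
      by (cases z) (auto simp: T_def cbox_Pair_eq)
    have "f (\<Phi> (u, r, s)) = 0"
      unfolding \<Phi>_def prod.case using inv[of "fst (\<phi> u)" "snd (\<phi> u)"] u(3) by simp
    then show "z \<in> g ` (D \<inter> {p. f p = 0})"
      unfolding z
      using g_\<Phi>[OF u(1,2), of s] \<Phi>_D[OF u(1,2), of s] by (metis (mono_tags, lifting) Int_iff image_eqI mem_Collect_eq)
  qed
  then have neg_T: "negligible (T \<times> cbox (1, 0) (2 :: real, 1 :: real))"
    using neg negligible_subset by blast
  have "continuous_on U \<phi>"
    using der by (auto intro!: continuous_at_imp_continuous_on has_derivative_continuous)
  moreover have "continuous_on UNIV f"
    using continuous_real_polymonial_function[OF f(1)] by (blast intro: continuous_at_imp_continuous_on)
  ultimately have "continuous_on U (\<lambda>u. f (\<phi> u))"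
    using continuous_on_compose2 by blast
  then have "open (U \<inter> (\<lambda>u. f (\<phi> u)) -` (- {0}))"
    using U by (intro continuous_open_preimage) auto
  then have "U - (U \<inter> (\<lambda>u. f (\<phi> u)) -` (- {0})) \<in> sets borel"
    using U by (intro sets.Diff borel_open)
  also have "U - (U \<inter> (\<lambda>u. f (\<phi> u)) -` (- {0})) = T"
    by (auto simp: T_def)
  finally have T: "T \<in> sets borel" .
  let ?B = "cbox (1, 0) (2 :: real, 1 :: real)"
  have "T \<times> ?B \<in> sets borel"
    using T by (intro borel_Times) auto
  then have "emeasure lborel (T \<times> ?B) = 0"
    using neg_T by (simp add: negligible_iff_null_sets null_sets_completion_iff null_sets_def)
  moreover have "emeasure (lborel \<Otimes>\<^sub>M lborel) (T \<times> ?B) = emeasure lborel T * emeasure lborel ?B"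
    using T by (intro lborel.emeasure_pair_measure_Times) auto
  moreover have "emeasure lborel ?B \<noteq> 0"
    by (simp add: emeasure_lborel_cbox_eq Basis_prod_def)
  ultimately have "emeasure lborel T = 0"
    by (simp add: lborel_prod)
  then have "negligible T"
    using T by (simp add: negligible_iff_null_sets null_sets_completion_iff null_sets_def)
  then show "negligible {u \<in> U. \<phi> u \<in> {p \<in> cotangent_S7. f p = 0}}"
    by (rule negligible_subset) (auto simp: T_def)
qed

section \<open>Hamiltonian vector fields\<close>

definition hamiltonian_at :: "((real^8) \<times> (real^8) \<Rightarrow> real) \<Rightarrow> (real^8) \<times> (real^8) \<Rightarrow> (real^8) \<times> (real^8) \<Rightarrow> bool" where
  "hamiltonian_at F p X \<longleftrightarrow> (F has_derivative canonical_form p X) (at p)"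

lemma hamiltonian_at_add:
  "hamiltonian_at F p X \<Longrightarrow> hamiltonian_at G p Y \<Longrightarrow> hamiltonian_at (\<lambda>p. F p + G p) p (X + Y)"
  unfolding hamiltonian_at_def by (drule (1) has_derivative_add) (simp add: canonical_form_linear[abs_def])

lemma hamiltonian_at_diff:
  "hamiltonian_at F p X \<Longrightarrow> hamiltonian_at G p Y \<Longrightarrow> hamiltonian_at (\<lambda>p. F p - G p) p (X - Y)"
  unfolding hamiltonian_at_def by (drule (1) has_derivative_diff) (simp add: canonical_form_linear[abs_def])

lemma hamiltonian_at_cmult:
  "hamiltonian_at F p X \<Longrightarrow> hamiltonian_at (\<lambda>p. r * F p) p (r *\<^sub>R X)"
  unfolding hamiltonian_at_def by (drule has_derivative_mult_right[of _ _ _ r]) (simp add: canonical_form_linear[abs_def])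

lemma hamiltonian_at_power2:
  "hamiltonian_at F p X \<Longrightarrow> hamiltonian_at (\<lambda>p. (F p)\<^sup>2) p ((2 * F p) *\<^sub>R X)"
  unfolding hamiltonian_at_def by (drule has_derivative_power[of _ _ _ _ 2]) (simp add: canonical_form_linear[abs_def] mult_ac)

lemmas hamiltonian_at_intros =
  hamiltonian_at_add hamiltonian_at_diff hamiltonian_at_cmult hamiltonian_at_power2

definition energy :: "(real^8) \<times> (real^8) \<Rightarrow> real" where
  "energy p = (fst p \<bullet> fst p) * (snd p \<bullet> snd p) - (fst p \<bullet> snd p)\<^sup>2"

definition energy_field :: "(real^8) \<times> (real^8) \<Rightarrow> (real^8) \<times> (real^8)" where
  "energy_field p = (2 *\<^sub>R snd p, (- 2 * (snd p \<bullet> snd p)) *\<^sub>R fst p)"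

(* Subtracting (q.\<xi>)^2 makes the ambient Hamiltonian vector field of the energy tangent to the
   cotangent bundle. *)
lemma hamiltonian_at_energy:
  assumes "p \<in> cotangent_S7"
  shows "hamiltonian_at energy p (energy_field p)"
proof -
  have "fst p \<bullet> fst p = 1" "fst p \<bullet> snd p = 0"
    using assms by (simp_all add: mem_cotangent_S7 norm_eq_1)
  moreover have "(energy has_derivative (\<lambda>h. 2 * (fst p \<bullet> fst h) * (snd p \<bullet> snd p)
      + (fst p \<bullet> fst p) * (2 * (snd p \<bullet> snd h))
      - 2 * (fst p \<bullet> snd p) * (fst h \<bullet> snd p + fst p \<bullet> snd h))) (at p)"
    unfolding energy_def[abs_def]
    by (rule derivative_eq_intros refl | simp add: inner_commute algebra_simps)+
  ultimately show ?thesis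
    by (simp add: hamiltonian_at_def canonical_form_def[abs_def] energy_field_def inner_commute algebra_simps)
qed

lemma energy_field_tangent:
  "p \<in> cotangent_S7 \<Longrightarrow> energy_field p \<in> tangent_space cotangent_S7 p"
  by (simp add: tangent_space_cotangent_S7 energy_field_def mem_cotangent_S7 norm_eq_1)

lemma smooth_on_energy: "smooth_on energy UNIV"
  unfolding energy_def[abs_def]
  by (intro smooth_on_diff smooth_on_mult smooth_on_inner smooth_on_power2
      smooth_on_bounded_linear bounded_linear_fst bounded_linear_snd)

definition skew :: "(real^8 \<Rightarrow> real^8) \<Rightarrow> bool" where
  "skew B \<longleftrightarrow> linear B \<and> (\<forall>x y. B x \<bullet> y = - (x \<bullet> B y))"

lemma skewD:
  assumes "skew B"
  shows "linear B" "B x \<bullet> y = - (x \<bullet> B y)" "B x \<bullet> x = 0" "x \<bullet> B x = 0"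
proof -
  show 1: "linear B" "B x \<bullet> y = - (x \<bullet> B y)" for x y using assms by (auto simp: skew_def)
  show "B x \<bullet> x = 0" "x \<bullet> B x = 0" using 1(2)[of x x] by (simp_all add: inner_commute)
qed

definition mom :: "(real^8 \<Rightarrow> real^8) \<Rightarrow> (real^8) \<times> (real^8) \<Rightarrow> real" where
  "mom B p = B (fst p) \<bullet> snd p"

definition mom_field :: "(real^8 \<Rightarrow> real^8) \<Rightarrow> (real^8) \<times> (real^8) \<Rightarrow> (real^8) \<times> (real^8)" where
  "mom_field B p = (B (fst p), B (snd p))"

lemma hamiltonian_at_mom:
  assumes "skew B"
  shows "hamiltonian_at (mom B) p (mom_field B p)"
proof -
  have B: "(B has_derivative B) (at x)" for x
    using skewD(1)[OF assms] by (simp add: linear_conv_bounded_linear bounded_linear_imp_has_derivative)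
  have "((\<lambda>p. B (fst p)) has_derivative (\<lambda>h. B (fst h))) (at p)"
    by (rule has_derivative_compose[OF has_derivative_fst[OF has_derivative_ident] B])
  then have "((\<lambda>p. B (fst p) \<bullet> snd p) has_derivative (\<lambda>h. B (fst p) \<bullet> snd h + B (fst h) \<bullet> snd p)) (at p)"
    by (intro has_derivative_inner has_derivative_snd has_derivative_ident)
  moreover have "(\<lambda>h. B (fst p) \<bullet> snd h + B (fst h) \<bullet> snd p) = canonical_form p (mom_field B p)"
    by (simp add: canonical_form_def[abs_def] mom_field_def skewD(2)[OF assms, of "fst _"] inner_commute[of "B (snd p)"])
  ultimately show ?thesis
    by (simp add: hamiltonian_at_def mom_def[abs_def])
qed

lemma mom_field_tangent:
  "skew B \<Longrightarrow> p \<in> cotangent_S7 \<Longrightarrow> mom_field B p \<in> tangent_space cotangent_S7 p"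
  by (simp add: tangent_space_cotangent_S7 mom_field_def skewD(2,4))

lemma canonical_form_mom_field:
  assumes "skew B" "skew C"
  shows "canonical_form p (mom_field B p) (mom_field C p) = mom (\<lambda>x. B (C x) - C (B x)) p"
  using skewD(2)[OF assms(2), of "B (fst p)" "snd p"] skewD(2)[OF assms(1), of "C (fst p)" "snd p"]
  by (simp add: canonical_form_def mom_field_def mom_def inner_diff_left inner_commute[of "B (snd p)"])

lemma canonical_form_energy_mom:
  assumes "skew B"
  shows "canonical_form p (energy_field p) (mom_field B p) = 0"
    "canonical_form p (mom_field B p) (energy_field p) = 0"
  using skewD(3,4)[OF assms] by (simp_all add: canonical_form_def mom_field_def energy_field_def)

lemma canonical_form_self: "canonical_form p X X = 0"
  by (simp add: canonical_form_def inner_commute)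

lemma smooth_on_mom:
  assumes "skew B" shows "smooth_on (mom B) UNIV"
  unfolding mom_def[abs_def]
  using bounded_linear_compose[OF skewD(1)[OF assms, unfolded linear_conv_bounded_linear] bounded_linear_fst]
  by (intro smooth_on_inner smooth_on_bounded_linear bounded_linear_snd)

lemma real_polynomial_function_mom:
  assumes "skew B" shows "real_polynomial_function (mom B)"
  unfolding mom_def[abs_def]
  using linear_compose[OF linear_fst skewD(1)[OF assms]]
  by (intro real_polynomial_function_inner_linear linear_snd) (simp add: o_def)

lemma mom_shift:
  assumes "skew B" shows "mom B (r *\<^sub>R q, \<xi> + s *\<^sub>R q) = r * mom B (q, \<xi>)"
  using skewD[OF assms] by (simp add: mom_def inner_add_right linear_scale)

lemma null_mom:
  assumes "skew B" "mom B a \<noteq> 0"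
  shows "null_in_submanifold TYPE(real^14) cotangent_S7 {p\<in>cotangent_S7. mom B p = 0}"
  using assms by (intro null_in_cotangent_S7[of "mom B" a] real_polynomial_function_mom) (simp_all add: mom_shift)

lemma null_in_submanifold_Un:
  "null_in_submanifold E N Z \<Longrightarrow> null_in_submanifold E N Z' \<Longrightarrow> null_in_submanifold E N (Z \<union> Z')"
proof -
  have "{u \<in> U. \<phi> u \<in> Z \<union> Z'} = {u \<in> U. \<phi> u \<in> Z} \<union> {u \<in> U. \<phi> u \<in> Z'}" for U and \<phi> :: "'a \<Rightarrow> 'b"
    by auto
  then show "null_in_submanifold E N Z \<Longrightarrow> null_in_submanifold E N Z' \<Longrightarrow> null_in_submanifold E N (Z \<union> Z')"
    unfolding null_in_submanifold_def by simp
qed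

lemma null_in_submanifold_subset:
  assumes "null_in_submanifold E N Z" "Z' \<subseteq> Z"
  shows "null_in_submanifold E N Z'"
  unfolding null_in_submanifold_def
proof (intro allI impI)
  fix U and \<phi> :: "'a \<Rightarrow> 'b" assume "local_parametrization N U \<phi>"
  then have "negligible {u \<in> U. \<phi> u \<in> Z}"
    using assms(1) by (simp add: null_in_submanifold_def)
  then show "negligible {u \<in> U. \<phi> u \<in> Z'}"
    by (rule negligible_subset) (use assms(2) in auto)
qed

lemma completely_integrable_cotangent_S7:
  fixes L :: "(((real^8) \<times> (real^8) \<Rightarrow> real) \<times> ((real^8) \<times> (real^8) \<Rightarrow> (real^8) \<times> (real^8))) list"
  assumes len: "length L = 7"
    and smooth: "\<And>F X. (F, X) \<in> set L \<Longrightarrow> smooth_on F UNIV"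
    and ham: "\<And>F X p. (F, X) \<in> set L \<Longrightarrow> p \<in> cotangent_S7 \<Longrightarrow> hamiltonian_at F p (X p)"
    and tangent: "\<And>F X p. (F, X) \<in> set L \<Longrightarrow> p \<in> cotangent_S7 \<Longrightarrow> X p \<in> tangent_space cotangent_S7 p"
    and commute: "\<And>F X G Y p. (F, X) \<in> set L \<Longrightarrow> (G, Y) \<in> set L \<Longrightarrow> p \<in> cotangent_S7 \<Longrightarrow>
      canonical_form p (X p) (Y p) = 0"
    and independent: "\<And>p c. p \<in> cotangent_S7 - Z \<Longrightarrow>
      (\<And>w. w \<in> tangent_space cotangent_S7 p \<Longrightarrow> (\<Sum>i<7. c i * canonical_form p (snd (L ! i) p) w) = 0) \<Longrightarrow>
      \<forall>i<7. c i = 0"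
    and null: "null_in_submanifold TYPE(real^14) cotangent_S7 Z"
    and H: "\<And>p. p \<in> cotangent_S7 \<Longrightarrow> fst (L ! 6) p = H p"
  shows "completely_integrable TYPE(real^14) cotangent_S7 canonical_form H"
proof -
  define F where "F i = fst (L ! (i - 1))" for i
  define X where "X i = snd (L ! (i - 1))" for i
  have FX: "(F i, X i) \<in> set L" if "i \<in> {1..7}" for i
  proof -
    have "L ! (i - 1) \<in> set L"
      using that len by (intro nth_mem) auto
    then show ?thesis by (simp add: F_def X_def)
  qed
  have vec: "hamiltonian_vector cotangent_S7 canonical_form (F i) p = X i p"
    if "i \<in> {1..7}" "p \<in> cotangent_S7" for i p
    using FX[OF that(1)] ham tangent that(2) by (intro hamiltonian_vector_eq) (auto simp: hamiltonian_at_def)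
  have "smooth_on_submanifold cotangent_S7 (F i)" if "i \<in> {1..7}" for i
    unfolding smooth_on_submanifold_def using smooth[OF FX[OF that]] by blast
  moreover have "poisson_bracket cotangent_S7 canonical_form (F i) (F j) p = 0"
    if "i \<in> {1..7}" "j \<in> {1..7}" "p \<in> cotangent_S7" for i j p
    using that commute[OF FX FX] by (simp add: poisson_bracket_def vec)
  moreover have "differentials_independent_at cotangent_S7 {1..7} F p" if p: "p \<in> cotangent_S7 - Z" for p
    unfolding differentials_independent_at_def
  proof (intro allI impI)
    fix c :: "nat \<Rightarrow> real"
    assume c: "\<forall>w\<in>tangent_space cotangent_S7 p. (\<Sum>i = 1..7. c i * differential cotangent_S7 (F i) p w) = 0"
    have "(\<Sum>i<7. c (Suc i) * canonical_form p (snd (L ! i) p) w) = 0"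
      if w: "w \<in> tangent_space cotangent_S7 p" for w
    proof -
      have "(\<Sum>i<7. c (Suc i) * canonical_form p (snd (L ! i) p) w) = (\<Sum>i = 1..7. c i * canonical_form p (X i p) w)"
        by (rule sum.reindex_bij_witness[of _ "\<lambda>i. i - 1" Suc]) (auto simp: X_def)
      also have "\<dots> = (\<Sum>i = 1..7. c i * differential cotangent_S7 (F i) p w)"
      proof (intro sum.cong refl)
        fix i :: nat assume "i \<in> {1..7}"
        then have "hamiltonian_at (F i) p (X i p)"
          using p by (intro ham[OF FX]) auto
        then show "c i * canonical_form p (X i p) w = c i * differential cotangent_S7 (F i) p w"
          by (simp add: hamiltonian_at_def differential_eq[OF _ w])
      qed
      finally show ?thesis using c w by simp
    qed
    then have *: "\<forall>i<7. c (Suc i) = 0"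
      using independent[OF p, of "\<lambda>i. c (Suc i)"] by blast
    show "\<forall>i\<in>{1..7}. c i = 0"
    proof
      fix i :: nat assume "i \<in> {1..7}"
      then show "c i = 0" using *[rule_format, of "i - 1"] by auto
    qed
  qed
  then have "{p \<in> cotangent_S7. \<not> differentials_independent_at cotangent_S7 {1..7} F p} \<subseteq> Z"
    by blast
  then have "null_in_submanifold TYPE(real^14) cotangent_S7
      {p \<in> cotangent_S7. \<not> differentials_independent_at cotangent_S7 {1..7} F p}"
    by (rule null_in_submanifold_subset[OF null])
  moreover have "F 7 p = H p" if "p \<in> cotangent_S7" for p
    using H[OF that] by (simp add: F_def)
  ultimately show ?thesis
    unfolding completely_integrable_def by (intro exI[of _ "7::nat"] exI[of _ F]) simp
qed

section \<open>Quaternionic splittings\<close>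

locale quaternionic_splitting =
  fixes I J T S P :: "real^8 \<Rightarrow> real^8"
  assumes skew_generators: "skew I" "skew J" "skew T" "skew S"
    and linear_P: "linear P" and symmetric_P: "\<And>x y. P x \<bullet> y = x \<bullet> P y" and P_P: "\<And>x. P (P x) = P x"
    and commute_P: "\<And>x. P (I x) = I (P x)" "\<And>x. P (J x) = J (P x)" "\<And>x. P (T x) = T (P x)" "\<And>x. P (S x) = S (P x)"
    and squares: "\<And>x. I (I x) = - x" "\<And>x. J (J x) = - x" "\<And>x. T (T x) = - x" "\<And>x. S (S x) = - x"
    and anticommute: "\<And>x. J (I x) = - I (J x)" "\<And>x. S (T x) = - T (S x)"
    and commute: "\<And>x. T (I x) = I (T x)" "\<And>x. T (J x) = J (T x)" "\<And>x. S (I x) = I (S x)" "\<And>x. S (J x) = J (S x)"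
    and nontrivial: "\<exists>x. x \<noteq> 0 \<and> P x = x" "\<exists>x. x \<noteq> 0 \<and> P x = 0"
begin

definition "K x = I (J x)"
definition "V x = T (S x)"
definition Pr :: "bool \<Rightarrow> real^8 \<Rightarrow> real^8" where "Pr b x = (if b then P x else x - P x)"

definition "m B b = mom (\<lambda>x. Pr b (B x))"
definition "X B b = mom_field (\<lambda>x. Pr b (B x))"

definition "split_skew B \<longleftrightarrow> skew B \<and> (\<forall>x. P (B x) = B (P x))"

lemmas lin = skew_generators[THEN skewD(1)]
lemmas lin_simps = lin[THEN linear_neg] lin[THEN linear_diff] linear_neg[OF linear_P] linear_diff[OF linear_P]

lemma split_skew: "split_skew I" "split_skew J" "split_skew K" "split_skew T" "split_skew S" "split_skew V"
proof -
  show "split_skew I" "split_skew J" "split_skew T" "split_skew S"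
    by (simp_all add: split_skew_def skew_generators commute_P)
  have "I (J x) \<bullet> y = - (x \<bullet> I (J y))" "T (S x) \<bullet> y = - (x \<bullet> T (S y))" for x y
    using skew_generators[THEN skewD(2)] anticommute by (metis inner_minus_right minus_minus)+
  then show "split_skew K" "split_skew V"
    using linear_compose[OF lin(2,1)] linear_compose[OF lin(4,3)]
    by (auto simp: split_skew_def skew_def K_def[abs_def] V_def[abs_def] commute_P o_def)
qed

lemma linear_Pr: "linear (Pr b)"
  unfolding Pr_def[abs_def] using linear_P by (cases b) (auto intro: linear_compose_sub linear_ident)

lemma symmetric_Pr: "Pr b x \<bullet> y = x \<bullet> Pr b y"
  by (simp add: Pr_def inner_simps symmetric_P)

lemma Pr_Pr: "Pr b (Pr b' x) = (if b = b' then Pr b x else 0)"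
  by (cases b; cases b') (simp_all add: Pr_def lin_simps P_P)

lemma Pr_commute: "split_skew B \<Longrightarrow> Pr b (B x) = B (Pr b x)"
  by (auto simp: split_skew_def Pr_def linear_diff dest: skewD(1))

lemma skew_block:
  assumes "split_skew B" shows "skew (\<lambda>x. Pr b (B x))"
  using assms linear_compose[OF skewD(1) linear_Pr, of B b] skewD(2)[of B]
  by (auto simp: skew_def symmetric_Pr Pr_commute split_skew_def o_def)

lemma bracket:
  assumes "split_skew B" "split_skew C"
  shows "canonical_form p (X B b p) (X C b' p) =
    (if b = b' then Pr b (B (C (fst p)) - C (B (fst p))) \<bullet> snd p else 0)"
proof -
  have "canonical_form p (X B b p) (X C b' p) =
    (Pr b (B (Pr b' (C (fst p)))) - Pr b' (C (Pr b (B (fst p))))) \<bullet> snd p"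
    using canonical_form_mom_field[OF skew_block skew_block, OF assms] by (simp add: X_def mom_def)
  also have "Pr b (B (Pr b' (C (fst p)))) = (if b = b' then Pr b (B (C (fst p))) else 0)"
    using assms by (simp add: Pr_Pr flip: Pr_commute)
  also have "Pr b' (C (Pr b (B (fst p)))) = (if b = b' then Pr b (C (B (fst p))) else 0)"
    using assms by (simp add: Pr_Pr flip: Pr_commute)
  finally show ?thesis by (simp add: linear_diff[OF linear_Pr])
qed

lemma m_eq: "m B b p = Pr b (B (fst p)) \<bullet> snd p"
  by (simp add: m_def mom_def)

lemma Pr_double: "Pr b (2 * x) = 2 *\<^sub>R Pr b x"
proof -
  have "2 * x = x + x" by (rule mult_2)
  then show ?thesis by (metis linear_add[OF linear_Pr] scaleR_2)
qed

lemma brackets: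
  "canonical_form p (X I b p) (X J b' p) = (if b = b' then 2 * m K b p else 0)"
  "canonical_form p (X J b p) (X I b' p) = (if b = b' then - 2 * m K b p else 0)"
  "canonical_form p (X J b p) (X K b' p) = (if b = b' then 2 * m I b p else 0)"
  "canonical_form p (X K b p) (X J b' p) = (if b = b' then - 2 * m I b p else 0)"
  "canonical_form p (X K b p) (X I b' p) = (if b = b' then 2 * m J b p else 0)"
  "canonical_form p (X I b p) (X K b' p) = (if b = b' then - 2 * m J b p else 0)"
  "canonical_form p (X T b p) (X S b' p) = (if b = b' then 2 * m V b p else 0)"
  by (simp_all add: bracket split_skew m_eq K_def V_def squares anticommute lin_simps Pr_double
      linear_neg[OF linear_Pr] inner_simps)

lemma bracket_same: "split_skew B \<Longrightarrow> canonical_form p (X B b p) (X B b' p) = 0"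
  by (simp add: bracket linear_0[OF linear_Pr])

lemma brackets_0:
  "canonical_form p (X T b p) (X I b' p) = 0" "canonical_form p (X I b p) (X T b' p) = 0"
  "canonical_form p (X T b p) (X J b' p) = 0" "canonical_form p (X J b p) (X T b' p) = 0"
  "canonical_form p (X T b p) (X K b' p) = 0" "canonical_form p (X K b p) (X T b' p) = 0"
  "canonical_form p (X I b p) (X S b' p) = 0"
  "canonical_form p (X J b p) (X S b' p) = 0"
  "canonical_form p (X K b p) (X S b' p) = 0"
  by (simp_all add: bracket split_skew K_def commute linear_0[OF linear_Pr])

lemma bracket_energy:
  "split_skew B \<Longrightarrow> canonical_form p (energy_field p) (X B b p) = 0"
  "split_skew B \<Longrightarrow> canonical_form p (X B b p) (energy_field p) = 0"
  unfolding X_def by (simp_all add: canonical_form_energy_mom skew_block)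

lemma m_intros:
  assumes "split_skew B"
  shows "smooth_on (m B b) UNIV" "hamiltonian_at (m B b) p (X B b p)"
  using skew_block[OF assms] by (simp_all add: m_def X_def smooth_on_mom hamiltonian_at_mom)

lemma X_tangent: "split_skew B \<Longrightarrow> p \<in> cotangent_S7 \<Longrightarrow> X B b p \<in> tangent_space cotangent_S7 p"
  unfolding X_def by (intro mom_field_tangent skew_block)

(* Two tangent vectors that detect the energy and the Casimirs: the derivative of every block
   momentum vanishes along the first, and the second rescales the momenta of one block. *)
definition "shear p = (0, P (fst p) - (fst p \<bullet> P (fst p)) *\<^sub>R fst p)"
definition "scaling b p = (0, Pr b (snd p) - (fst p \<bullet> Pr b (snd p)) *\<^sub>R fst p)"

lemma test_tangent:
  assumes "p \<in> cotangent_S7"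
  shows "shear p \<in> tangent_space cotangent_S7 p" "scaling b p \<in> tangent_space cotangent_S7 p"
  using assms by (simp_all add: tangent_space_cotangent_S7 shear_def scaling_def mem_cotangent_S7 norm_eq_1 inner_simps)

lemma X_shear:
  assumes "split_skew B" shows "canonical_form p (X B b p) (shear p) = 0"
proof -
  note sk = skew_block[OF assms, of b]
  have "Pr b (B x) \<bullet> P x = 0" for x
  proof (cases b)
    case True
    then show ?thesis
      using assms by (simp add: Pr_def split_skew_def skewD(3))
  next
    case False
    have "Pr b (B x) \<bullet> P x = P (B x - P (B x)) \<bullet> x"
      using False by (simp add: Pr_def symmetric_P)
    then show ?thesis by (simp add: lin_simps P_P)
  qed
  then show ?thesis
    using skewD(3)[OF sk] by (simp add: canonical_form_def X_def mom_field_def shear_def inner_simps)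
qed

lemma energy_shear:
  "p \<in> cotangent_S7 \<Longrightarrow> canonical_form p (energy_field p) (shear p) = 2 * (P (fst p) \<bullet> snd p)"
  by (simp add: canonical_form_def energy_field_def shear_def inner_simps inner_commute mem_cotangent_S7)

lemma X_scaling:
  assumes "split_skew B" shows "canonical_form p (X B b p) (scaling b' p) = (if b = b' then m B b p else 0)"
  using skewD(3)[OF skew_block[OF assms, of b]]
  by (auto simp: canonical_form_def X_def mom_field_def scaling_def inner_simps m_eq Pr_Pr symmetric_Pr[symmetric]) 

end

lemma sum_lessThan_7: "(\<Sum>i<7. f i) = f 0 + f 1 + f 2 + f 3 + f 4 + f 5 + f (6::nat)" for f :: "nat \<Rightarrow> real"
  by (simp add: eval_nat_numeral)

lemma all_less_7: "(\<forall>i<7. Q i) \<longleftrightarrow> Q 0 \<and> Q 1 \<and> Q 2 \<and> Q 3 \<and> Q 4 \<and> Q 5 \<and> Q (6::nat)"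
  by (simp add: eval_nat_numeral less_Suc_eq all_conj_distrib imp_disjL)

lemma subspace_tangent_space_cotangent_S7:
  "p \<in> cotangent_S7 \<Longrightarrow> subspace (tangent_space cotangent_S7 p)"
  by (auto simp: subspace_def tangent_space_cotangent_S7 inner_simps algebra_simps simp flip: distrib_left)

context quaternionic_splitting
begin

definition "cas b p = (m I b p)\<^sup>2 + (m J b p)\<^sup>2 + (m K b p)\<^sup>2"
definition "cas_field b p = (2 * m I b p) *\<^sub>R X I b p + (2 * m J b p) *\<^sub>R X J b p + (2 * m K b p) *\<^sub>R X K b p"

lemma cas: "smooth_on (cas b) UNIV" "hamiltonian_at (cas b) p (cas_field b p)"
  unfolding cas_def[abs_def] cas_field_def
  by (intro smooth_on_add smooth_on_power2 hamiltonian_at_intros m_intros split_skew)+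

lemma cas_field_scaling:
  "canonical_form p (cas_field b p) (scaling b' p) = (if b = b' then 2 * cas b p else 0)"
  by (simp add: cas_field_def cas_def canonical_form_linear X_scaling split_skew power2_eq_square)

definition "msum B p = m B True p + m B False p"
definition "sum_field B p = X B True p + X B False p"

lemma msum:
  "split_skew B \<Longrightarrow> smooth_on (msum B) UNIV" "split_skew B \<Longrightarrow> hamiltonian_at (msum B) p (sum_field B p)"
  unfolding msum_def[abs_def] sum_field_def
  by (intro smooth_on_add hamiltonian_at_add m_intros; assumption)+

(* With k = 1 this is the Casimir of the diagonal sp(1) spanned by I, J, K, with k = -1 that of its
   twisted copy in which K has the opposite sign on the second block. *)
definition "coupling k p = (msum I p)\<^sup>2 + (msum J p)\<^sup>2 + (m K True p + k * m K False p)\<^sup>2"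
definition "coupling_field k p = (2 * msum I p) *\<^sub>R sum_field I p + (2 * msum J p) *\<^sub>R sum_field J p
  + (2 * (m K True p + k * m K False p)) *\<^sub>R (X K True p + k *\<^sub>R X K False p)"

lemma coupling: "smooth_on (coupling k) UNIV" "hamiltonian_at (coupling k) p (coupling_field k p)"
  unfolding coupling_def[abs_def] coupling_field_def
  by (intro smooth_on_add smooth_on_mult smooth_on_const smooth_on_power2 msum
      hamiltonian_at_intros m_intros split_skew)+

definition "ham_K k e p = 1/2 * energy p - 1/2 * coupling k p + e * (msum K p)\<^sup>2"
definition "ham_K_field k e p = (1/2) *\<^sub>R energy_field p - (1/2) *\<^sub>R coupling_field k p
  + e *\<^sub>R (2 * msum K p) *\<^sub>R sum_field K p"

lemma ham_K:
  "smooth_on (ham_K k e) UNIV" "p \<in> cotangent_S7 \<Longrightarrow> hamiltonian_at (ham_K k e) p (ham_K_field k e p)"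
  unfolding ham_K_def[abs_def] ham_K_field_def
  by (intro smooth_on_add smooth_on_diff smooth_on_mult smooth_on_const smooth_on_power2 smooth_on_energy
      msum coupling split_skew hamiltonian_at_intros hamiltonian_at_energy; assumption)+

definition "ham_J p = 1/2 * energy p - 1/2 * (msum J p)\<^sup>2"
definition "ham_J_field p = (1/2) *\<^sub>R energy_field p - (1/2) *\<^sub>R (2 * msum J p) *\<^sub>R sum_field J p"

lemma ham_J:
  "smooth_on ham_J UNIV" "p \<in> cotangent_S7 \<Longrightarrow> hamiltonian_at ham_J p (ham_J_field p)"
  unfolding ham_J_def[abs_def] ham_J_field_def
  by (intro smooth_on_diff smooth_on_mult smooth_on_const smooth_on_power2 smooth_on_energy
      msum split_skew hamiltonian_at_intros hamiltonian_at_energy; assumption)+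

lemmas field_defs = cas_field_def sum_field_def coupling_field_def ham_K_field_def ham_J_field_def

lemma tangent_fields:
  assumes p: "p \<in> cotangent_S7"
  shows "cas_field b p \<in> tangent_space cotangent_S7 p" "sum_field K p \<in> tangent_space cotangent_S7 p"
    "coupling_field k p \<in> tangent_space cotangent_S7 p" "ham_K_field k e p \<in> tangent_space cotangent_S7 p"
    "ham_J_field p \<in> tangent_space cotangent_S7 p"
proof -
  note subspace = subspace_tangent_space_cotangent_S7[OF p]
  show "cas_field b p \<in> tangent_space cotangent_S7 p" "sum_field K p \<in> tangent_space cotangent_S7 p"
    "coupling_field k p \<in> tangent_space cotangent_S7 p" "ham_K_field k e p \<in> tangent_space cotangent_S7 p"
    "ham_J_field p \<in> tangent_space cotangent_S7 p"
    unfolding field_defs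
    by (intro subspace_add[OF subspace] subspace_diff[OF subspace] subspace_scale[OF subspace]
        X_tangent split_skew p energy_field_tangent)+
qed

lemmas bracket_simps = canonical_form_linear brackets brackets_0 bracket_same bracket_energy split_skew
  canonical_form_self

(* A form of P q . \<xi> that is homogeneous in q and invariant under \<xi> \<mapsto> \<xi> + s q. *)
definition "cross_height p = (P (fst p) \<bullet> snd p) * ((fst p - P (fst p)) \<bullet> fst p)
  - ((fst p - P (fst p)) \<bullet> snd p) * (P (fst p) \<bullet> fst p)"

lemma cross_height_eq: "p \<in> cotangent_S7 \<Longrightarrow> cross_height p = P (fst p) \<bullet> snd p"
  by (simp add: cross_height_def mem_cotangent_S7 norm_eq_1 inner_simps algebra_simps)

lemma null_cross_height: "null_in_submanifold TYPE(real^14) cotangent_S7 {p\<in>cotangent_S7. P (fst p) \<bullet> snd p = 0}"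
proof -
  obtain x y where x: "x \<noteq> 0" "P x = x" and y: "y \<noteq> 0" "P y = 0"
    using nontrivial by blast
  have xy: "x \<bullet> y = 0" using symmetric_P[of x y] x y by simp
  have lin: "linear (\<lambda>p. P (fst p))" "linear (\<lambda>p. fst p - P (fst p))"
    using linear_compose[OF linear_fst linear_P] linear_fst
    by (auto simp: o_def intro: linear_compose_sub)
  have "null_in_submanifold TYPE(real^14) cotangent_S7 {p\<in>cotangent_S7. cross_height p = 0}"
  proof (rule null_in_cotangent_S7[of cross_height "(x + y, x)"])
    show "real_polynomial_function cross_height"
      unfolding cross_height_def[abs_def]
      by (intro real_polynomial_function_diff real_polynomial_function.intros(4)
          real_polynomial_function_inner_linear lin linear_fst linear_snd)
    show "cross_height (x + y, x) \<noteq> 0"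
      using x y xy by (simp add: cross_height_def linear_add[OF linear_P] inner_simps inner_commute)
    show "cross_height (r *\<^sub>R q, \<xi> + s *\<^sub>R q) = 0" if "cross_height (q, \<xi>) = 0" for q \<xi> r s
    proof -
      have "cross_height (r *\<^sub>R q, \<xi> + s *\<^sub>R q) = r ^ 3 * cross_height (q, \<xi>)"
        by (simp add: cross_height_def linear_scale[OF linear_P] inner_simps algebra_simps power3_eq_cube)
      then show ?thesis using that by simp
    qed
  qed simp
  then show ?thesis
    by (rule null_in_submanifold_subset) (auto simp: cross_height_eq)
qed

lemma null_m:
  assumes "split_skew B" "\<And>x. B (B x) = - x"
  shows "null_in_submanifold TYPE(real^14) cotangent_S7 {p\<in>cotangent_S7. m B b p = 0}"
proof -
  obtain x where x: "x \<noteq> 0" "Pr b x = x"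
    using nontrivial by (cases b) (auto simp: Pr_def)
  have "m B b (x, B x) = x \<bullet> x"
    using assms x by (simp add: m_eq Pr_commute) (simp add: split_skew_def skewD(2))
  then show ?thesis
    unfolding m_def using x(1) by (intro null_mom[of _ "(x, B x)"] skew_block assms) (simp add: m_def)
qed

definition "twist p = m I True p * m J False p - m J True p * m I False p"

lemma null_twist: "null_in_submanifold TYPE(real^14) cotangent_S7 {p\<in>cotangent_S7. twist p = 0}"
proof -
  obtain x y where x: "x \<noteq> 0" "P x = x" and y: "y \<noteq> 0" "P y = 0"
    using nontrivial by blast
  have skewK: "z \<bullet> I (J z) = 0" for z
    using split_skew(3) by (simp add: split_skew_def skewD(4) flip: K_def)
  show ?thesis
  proof (rule null_in_cotangent_S7[of twist "(x + y, I x + J y)"])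
    show "real_polynomial_function twist"
      unfolding twist_def[abs_def] m_def
      by (intro real_polynomial_function_diff real_polynomial_function.intros(4) real_polynomial_function_mom skew_block split_skew)
    have I: "I z \<bullet> I w = z \<bullet> w" and J: "J z \<bullet> J w = z \<bullet> w" for z w
      using skew_generators[THEN skewD(2)] squares by simp_all
    have IJ: "I z \<bullet> J z = 0" "J z \<bullet> I z = 0" for z
      using skewD(2)[OF skew_generators(1), of z "J z"] skewK[of z] by (simp_all add: inner_commute)
    have xy: "B x \<bullet> C y = 0" "B y \<bullet> C x = 0" if "split_skew B" "split_skew C" for B C
    proof -
      have "P (B x) = B x" "P (C y) = 0" "P (C x) = C x" "P (B y) = 0"
        using that x y by (simp_all add: split_skew_def linear_0[OF skewD(1)])
      then show "B x \<bullet> C y = 0" "B y \<bullet> C x = 0"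
        using symmetric_P[of "B x" "C y"] symmetric_P[of "B y" "C x"] by simp_all
    qed
    have PB: "P (B (x + y)) = B x" if "split_skew B" for B
      using that x y by (simp add: split_skew_def linear_add[OF linear_P] linear_add[OF skewD(1)] linear_0[OF skewD(1)])
    have B: "B (x + y) - B x = B y" if "split_skew B" for B
      using that by (simp add: split_skew_def linear_add[OF skewD(1)])
    have xy0: "x \<bullet> y = 0" "y \<bullet> x = 0" using symmetric_P[of x y] x y by (simp_all add: inner_commute)
    have "twist (x + y, I x + J y) = (x \<bullet> x) * (y \<bullet> y)"
      by (simp add: twist_def m_eq Pr_def PB B split_skew inner_add_right I J IJ xy xy0)
    then show "twist (x + y, I x + J y) \<noteq> 0" using x y by simp
    show "twist (r *\<^sub>R q, \<xi> + s *\<^sub>R q) = 0" if "twist (q, \<xi>) = 0" for q \<xi> r s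
    proof -
      have "twist (r *\<^sub>R q, \<xi> + s *\<^sub>R q) = r\<^sup>2 * twist (q, \<xi>)"
        unfolding twist_def m_def
        by (simp add: mom_shift skew_block split_skew power2_eq_square algebra_simps)
      then show ?thesis using that by simp
    qed
  qed simp
qed

lemma K_K: "K (K x) = - x" and V_V: "V (V x) = - x"
  by (simp_all add: K_def V_def anticommute squares lin_simps)

lemma cas_pos: "m B b p \<noteq> 0 \<Longrightarrow> B \<in> {I, J, K} \<Longrightarrow> cas b p \<noteq> 0"
  unfolding cas_def by (smt (verit, best) insertE singletonD zero_eq_power2 zero_le_power2)

lemma completely_integrable_K:
  assumes "\<And>p. p \<in> cotangent_S7 \<Longrightarrow> ham_K k e p = H p"
  shows "completely_integrable TYPE(real^14) cotangent_S7 canonical_form H"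
proof -
  let ?L = "[(cas True, cas_field True), (cas False, cas_field False), (m T True, X T True), (m T False, X T False),
    (msum K, sum_field K), (coupling k, coupling_field k), (ham_K k e, ham_K_field k e)]"
  let ?Z = "{p\<in>cotangent_S7. P (fst p) \<bullet> snd p = 0} \<union> {p\<in>cotangent_S7. m V True p = 0} \<union> {p\<in>cotangent_S7. m V False p = 0}
    \<union> {p\<in>cotangent_S7. twist p = 0} \<union> {p\<in>cotangent_S7. m J True p = 0}"
  show ?thesis
  proof (rule completely_integrable_cotangent_S7[of ?L ?Z])
    show "length ?L = 7" by simp
    show "smooth_on F UNIV" if "(F, Y) \<in> set ?L" for F Y
      using that by (auto intro: cas coupling ham_K msum split_skew m_intros)
    show "hamiltonian_at F p (Y p)" if "(F, Y) \<in> set ?L" "p \<in> cotangent_S7" for F Y p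
      using that by (auto intro: cas coupling ham_K msum split_skew m_intros)
    show "Y p \<in> tangent_space cotangent_S7 p" if "(F, Y) \<in> set ?L" "p \<in> cotangent_S7" for F Y p
      using that by (auto intro: tangent_fields X_tangent split_skew)
    show "canonical_form p (Y p) (Y' p) = 0" if "(F, Y) \<in> set ?L" "(F', Y') \<in> set ?L" for F Y F' Y' p
    proof -
      have "\<forall>Y\<in>snd ` set ?L. \<forall>Y'\<in>snd ` set ?L. canonical_form p (Y p) (Y' p) = 0"
        by (simp add: field_defs bracket_simps msum_def algebra_simps)
      with that show ?thesis by force
    qed
    show "null_in_submanifold TYPE(real^14) cotangent_S7 ?Z"
      by (intro null_in_submanifold_Un null_cross_height null_m null_twist split_skew V_V squares)
    show "fst (?L ! 6) p = H p" if "p \<in> cotangent_S7" for p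
      using assms[OF that] by simp
  next
    fix p and c :: "nat \<Rightarrow> real"
    assume p: "p \<in> cotangent_S7 - ?Z"
      and *: "\<And>w. w \<in> tangent_space cotangent_S7 p \<Longrightarrow> (\<Sum>i<7. c i * canonical_form p (snd (?L ! i) p) w) = 0"
    have pN: "p \<in> cotangent_S7"
      and nz: "P (fst p) \<bullet> snd p \<noteq> 0" "m V True p \<noteq> 0" "m V False p \<noteq> 0" "twist p \<noteq> 0" "m J True p \<noteq> 0"
      using p by auto
    have "m I False p \<noteq> 0 \<or> m J False p \<noteq> 0"
      using nz(4) by (auto simp: twist_def)
    then have cas: "cas True p \<noteq> 0" "cas False p \<noteq> 0"
      using nz(5) cas_pos by blast+
    note ** = *[unfolded sum_lessThan_7, simplified]
    note X_in = X_tangent[OF _ pN]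
    have c6: "c 6 = 0"
      using **[OF test_tangent(1)[OF pN]] nz(1)
      by (simp add: field_defs canonical_form_linear X_shear split_skew energy_shear pN)
    have c2: "c 2 = 0"
      using **[OF X_in[OF split_skew(5), of True]] c6 nz(2) by (simp add: field_defs bracket_simps)
    have c3: "c 3 = 0"
      using **[OF X_in[OF split_skew(5), of False]] c6 nz(3) by (simp add: field_defs bracket_simps)
    have "c 5 * twist p = 0"
      using **[OF X_in[OF split_skew(3), of True]] c6 c2 c3
      by (simp add: field_defs bracket_simps msum_def twist_def algebra_simps)
    with nz(4) have c5: "c 5 = 0" by simp
    have c4: "c 4 = 0"
      using **[OF X_in[OF split_skew(1), of True]] c6 c2 c3 c5 nz(5)
      by (simp add: field_defs bracket_simps algebra_simps)
    have "c 0 = 0" "c 1 = 0"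
      using **[OF test_tangent(2)[OF pN, of True]] **[OF test_tangent(2)[OF pN, of False]] c2 c3 c4 c5 c6 cas
      by (simp_all add: cas_field_scaling)
    with c2 c3 c4 c5 c6 show "\<forall>i<7. c i = 0" by (simp add: all_less_7)
  qed
qed

lemma completely_integrable_J:
  assumes "\<And>p. p \<in> cotangent_S7 \<Longrightarrow> ham_J p = H p"
  shows "completely_integrable TYPE(real^14) cotangent_S7 canonical_form H"
proof -
  let ?L = "[(cas True, cas_field True), (cas False, cas_field False), (m T True, X T True), (m T False, X T False),
    (m J True, X J True), (m J False, X J False), (ham_J, ham_J_field)]"
  let ?Z = "{p\<in>cotangent_S7. P (fst p) \<bullet> snd p = 0} \<union> {p\<in>cotangent_S7. m V True p = 0} \<union> {p\<in>cotangent_S7. m V False p = 0}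
    \<union> {p\<in>cotangent_S7. m K True p = 0} \<union> {p\<in>cotangent_S7. m K False p = 0}"
  show ?thesis
  proof (rule completely_integrable_cotangent_S7[of ?L ?Z])
    show "length ?L = 7" by simp
    show "smooth_on F UNIV" if "(F, Y) \<in> set ?L" for F Y
      using that by (auto intro: cas ham_J split_skew m_intros)
    show "hamiltonian_at F p (Y p)" if "(F, Y) \<in> set ?L" "p \<in> cotangent_S7" for F Y p
      using that by (auto intro: cas ham_J split_skew m_intros)
    show "Y p \<in> tangent_space cotangent_S7 p" if "(F, Y) \<in> set ?L" "p \<in> cotangent_S7" for F Y p
      using that by (auto intro: tangent_fields X_tangent split_skew)
    show "canonical_form p (Y p) (Y' p) = 0" if "(F, Y) \<in> set ?L" "(F', Y') \<in> set ?L" for F Y F' Y' p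
    proof -
      have "\<forall>Y\<in>snd ` set ?L. \<forall>Y'\<in>snd ` set ?L. canonical_form p (Y p) (Y' p) = 0"
        by (simp add: field_defs bracket_simps msum_def algebra_simps)
      with that show ?thesis by force
    qed
    show "null_in_submanifold TYPE(real^14) cotangent_S7 ?Z"
      by (intro null_in_submanifold_Un null_cross_height null_m split_skew V_V K_K)
    show "fst (?L ! 6) p = H p" if "p \<in> cotangent_S7" for p
      using assms[OF that] by simp
  next
    fix p and c :: "nat \<Rightarrow> real"
    assume p: "p \<in> cotangent_S7 - ?Z"
      and *: "\<And>w. w \<in> tangent_space cotangent_S7 p \<Longrightarrow> (\<Sum>i<7. c i * canonical_form p (snd (?L ! i) p) w) = 0"
    have pN: "p \<in> cotangent_S7"
      and nz: "P (fst p) \<bullet> snd p \<noteq> 0" "m V True p \<noteq> 0" "m V False p \<noteq> 0" "m K True p \<noteq> 0" "m K False p \<noteq> 0"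
      using p by auto
    have cas: "cas True p \<noteq> 0" "cas False p \<noteq> 0"
      using nz(4,5) cas_pos[of K] by auto
    note ** = *[unfolded sum_lessThan_7, simplified]
    note X_in = X_tangent[OF _ pN]
    have c6: "c 6 = 0"
      using **[OF test_tangent(1)[OF pN]] nz(1)
      by (simp add: field_defs canonical_form_linear X_shear split_skew energy_shear pN)
    have c2: "c 2 = 0"
      using **[OF X_in[OF split_skew(5), of True]] c6 nz(2) by (simp add: field_defs bracket_simps)
    have c3: "c 3 = 0"
      using **[OF X_in[OF split_skew(5), of False]] c6 nz(3) by (simp add: field_defs bracket_simps)
    have c4: "c 4 = 0"
      using **[OF X_in[OF split_skew(1), of True]] c6 c2 c3 nz(4)
      by (simp add: field_defs bracket_simps algebra_simps)
    have c5: "c 5 = 0"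
      using **[OF X_in[OF split_skew(1), of False]] c6 c2 c3 nz(5)
      by (simp add: field_defs bracket_simps algebra_simps)
    have "c 0 = 0" "c 1 = 0"
      using **[OF test_tangent(2)[OF pN, of True]] **[OF test_tangent(2)[OF pN, of False]] c2 c3 c4 c5 c6 cas
      by (simp_all add: cas_field_scaling)
    with c2 c3 c4 c5 c6 show "\<forall>i<7. c i = 0" by (simp add: all_less_7)
  qed
qed

end

section \<open>Clifford families\<close>

locale clifford =
  fixes A :: "nat \<Rightarrow> real^8^8"
  assumes family: "clifford_family A"
begin

definition "a i x = A i *v x"

lemma linear_a: "linear (a i)"
  unfolding a_def[abs_def] by (rule matrix_vector_mul_linear)

lemma skew_a:
  assumes "i \<in> {1..7}"
  shows "skew (a i)"
proof -
  have "a i x \<bullet> y = - (x \<bullet> a i y)" for x y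
  proof -
    have "a i x \<bullet> y = x \<bullet> (transpose (A i) *v y)"
      unfolding a_def by (metis dot_lmul_matrix inner_commute transpose_matrix_vector transpose_transpose)
    also have "transpose (A i) = - A i"
      using family assms by (simp add: clifford_family_def)
    also have "(- A i) *v y = - (A i *v y)"
      by (simp add: matrix_vector_mult_def vec_eq_iff sum_negf)
    finally show ?thesis
      by (simp add: a_def)
  qed
  then show ?thesis by (simp add: skew_def linear_a)
qed

lemma clifford_relation:
  assumes "i \<in> {1..7}" "j \<in> {1..7}"
  shows "a i (a j x) + a j (a i x) = (- 2 * (if i = j then 1 else 0)) *\<^sub>R x"
proof -
  have "(A i ** A j + A j ** A i) *v x = ((- 2 * (if i = j then 1 else 0)) *\<^sub>R mat 1) *v x"
    using family assms by (simp add: clifford_family_def)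
  then show ?thesis
    by (simp only: a_def matrix_vector_mult_add_rdistrib matrix_vector_mul_assoc[symmetric]
        scaleR_matrix_vector_assoc[symmetric] matrix_vector_mul_lid)
qed

lemma a_square:
  assumes "i \<in> {1..7}"
  shows "a i (a i x) = - x"
proof -
  have "2 *\<^sub>R a i (a i x) = 2 *\<^sub>R (- x)"
    using clifford_relation[OF assms assms, of x] by (simp add: scaleR_2)
  then show ?thesis by (rule scaleR_left_imp_eq[rotated]) simp
qed

lemma a_anticommute:
  assumes "i \<in> {1..7}" "j \<in> {1..7}" "j < i"
  shows "a i (a j x) = - a j (a i x)"
  using clifford_relation[OF assms(1,2), of x] assms(3) by (simp add: eq_neg_iff_add_eq_0)

(* Rewriting with these sorts every word in the generators; the index 1 is left out because the
   simplifier would turn it into Suc 0. *)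
lemma sort_words:
  "a 3 (a 2 x) = - a 2 (a 3 x)" "a 4 (a 2 x) = - a 2 (a 4 x)" "a 4 (a 3 x) = - a 3 (a 4 x)"
  "a 5 (a 2 x) = - a 2 (a 5 x)" "a 5 (a 3 x) = - a 3 (a 5 x)" "a 5 (a 4 x) = - a 4 (a 5 x)"
  "a 6 (a 2 x) = - a 2 (a 6 x)" "a 6 (a 3 x) = - a 3 (a 6 x)" "a 6 (a 4 x) = - a 4 (a 6 x)"
  "a 6 (a 5 x) = - a 5 (a 6 x)" "a 7 (a 2 x) = - a 2 (a 7 x)" "a 7 (a 3 x) = - a 3 (a 7 x)"
  "a 7 (a 4 x) = - a 4 (a 7 x)" "a 7 (a 5 x) = - a 5 (a 7 x)" "a 7 (a 6 x) = - a 6 (a 7 x)"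
  "a 2 (a 2 x) = - x" "a 3 (a 3 x) = - x" "a 4 (a 4 x) = - x"
  "a 5 (a 5 x) = - x" "a 6 (a 6 x) = - x" "a 7 (a 7 x) = - x"
  by (rule a_anticommute a_square; simp)+

lemmas a_linear = linear_add[OF linear_a] linear_diff[OF linear_a] linear_neg[OF linear_a] linear_scale[OF linear_a]

(* The projection onto the fixed space of the involution A5 A6 A7, one of the two blocks. *)
definition "proj x = (1/2) *\<^sub>R (x + a 5 (a 6 (a 7 x)))"

lemma a_inner: "i \<in> {1..7} \<Longrightarrow> a i x \<bullet> y = - (x \<bullet> a i y)"
  by (rule skewD(2)[OF skew_a])

lemma skew_word2:
  assumes "i \<in> {1..7}" "j \<in> {1..7}" "j < i"
  shows "skew (\<lambda>x. a j (a i x))"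
proof -
  have "linear (\<lambda>x. a j (a i x))"
    using linear_compose[OF linear_a[of i] linear_a[of j]] by (simp add: o_def)
  moreover have "a j (a i x) \<bullet> y = - (x \<bullet> a j (a i y))" for x y
    by (simp only: a_inner[OF assms(1)] a_inner[OF assms(2)] a_anticommute[OF assms] inner_minus_right minus_minus)
  ultimately show ?thesis by (simp add: skew_def)
qed

sublocale quaternionic_splitting "a 6" "a 7" "\<lambda>x. a 2 (a 3 x)" "\<lambda>x. a 2 (a 4 x)" proj
proof (rule quaternionic_splitting.intro)
  show "skew (a 6)" "skew (a 7)" by (rule skew_a; simp)+
  show "skew (\<lambda>x. a 2 (a 3 x))" "skew (\<lambda>x. a 2 (a 4 x))" by (rule skew_word2; simp)+
  show "linear proj"
    by (rule linearI) (simp_all add: proj_def a_linear scaleR_add_right algebra_simps)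
  show "proj x \<bullet> y = x \<bullet> proj y" for x y
    by (simp add: proj_def inner_simps a_inner sort_words a_linear)
  have "a 5 (a 6 (a 7 (a 5 (a 6 (a 7 x))))) = x" for x
    by (simp add: sort_words a_linear)
  then have pp: "proj (proj x) = (1/2) *\<^sub>R (1/2) *\<^sub>R ((x + a 5 (a 6 (a 7 x))) + (x + a 5 (a 6 (a 7 x))))" for x
    by (simp add: proj_def a_linear algebra_simps)
  show "proj (proj x) = proj x" for x
    unfolding pp by (simp add: proj_def flip: scaleR_2)
  obtain y where "y \<noteq> (0 :: real^8)"
    using ex_card by (metis axis_eq_0_iff zero_neq_one)
  have a2_proj: "proj (a 2 x) = a 2 (x - proj x)" for x
  proof -
    have "x - proj x = (1/2) *\<^sub>R (x - a 5 (a 6 (a 7 x)))"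
      using scaleR_half_double[of x] by (simp add: proj_def algebra_simps)
    then show ?thesis by (simp add: proj_def a_linear sort_words)
  qed
  have a2_inj: "a 2 x \<noteq> 0" if "x \<noteq> 0" for x
    using that a_square[of 2 x] linear_0[OF linear_a] by force
  have proj_0: "proj 0 = 0" and proj_diff: "proj (x - y) = proj x - proj y" for x y
    using \<open>linear proj\<close> by (simp_all add: linear_0 linear_diff)
  obtain z where z: "z \<noteq> 0" "proj z = z"
  proof (cases "proj y = 0")
    case True
    then show ?thesis using that[of "a 2 y"] a2_proj[of y] a2_inj[of y] \<open>y \<noteq> 0\<close> by simp
  next
    case False
    then show ?thesis using that[of "proj y"] \<open>proj (proj y) = proj y\<close> by simp
  qed
  then show "\<exists>x. x \<noteq> 0 \<and> proj x = x" by blast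
  have "proj (a 2 z) = 0" using a2_proj[of z] z linear_0[OF linear_a] by simp
  then show "\<exists>x. x \<noteq> 0 \<and> proj x = 0" using a2_inj[OF z(1)] by blast
qed (simp_all add: proj_def sort_words a_linear)

lemma parseval:
  assumes "p \<in> cotangent_S7"
  shows "(\<Sum>i=1..7. (a i (fst p) \<bullet> snd p)\<^sup>2) = snd p \<bullet> snd p"
proof -
  define q where "q = fst p"
  have q: "q \<bullet> q = 1" "q \<bullet> snd p = 0"
    using assms by (simp_all add: q_def mem_cotangent_S7 norm_eq_1)
  define e where "e i = (if i = 0 then q else a i q)" for i
  have orth: "e i \<bullet> e j = (if i = j then 1 else 0)" if "i \<in> {..7}" "j \<in> {..7}" for i j
  proof -
    have 0: "a i q \<bullet> q = 0" "q \<bullet> a i q = 0" if "i \<in> {1..7}" for i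
      using skewD(3,4)[OF skew_a[OF that]] by auto
    have "a i q \<bullet> a j q = (if i = j then 1 else 0)" if "i \<in> {1..7}" "j \<in> {1..7}"
    proof -
      have "2 * (a i q \<bullet> a j q) = - (q \<bullet> (a i (a j q) + a j (a i q)))"
        using a_inner[OF that(1), of q "a j q"] a_inner[OF that(2), of q "a i q"]
        by (simp add: inner_add_right inner_commute)
      then show ?thesis using q by (simp add: clifford_relation[OF that])
    qed
    then show ?thesis using 0 q that by (auto simp: e_def)
  qed
  have inj: "inj_on e {..7}"
    by (rule inj_onI) (metis orth zero_neq_one)
  let ?B = "e ` {..7}"
  have po: "pairwise orthogonal ?B"
    unfolding pairwise_def orthogonal_def using orth by (metis (no_types, lifting) imageE)
  have unit: "norm b = 1" if "b \<in> ?B" for b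
    using that orth by (auto simp: norm_eq_1)
  have "independent ?B"
    using po unit[of 0] by (intro pairwise_orthogonal_independent) auto
  moreover have "card ?B = 8"
    using inj by (simp add: card_image)
  ultimately have "UNIV \<subseteq> span ?B"
    by (intro card_ge_dim_independent) auto
  then have "snd p = (\<Sum>b\<in>?B. (snd p \<bullet> b) *\<^sub>R b)"
    by (intro orthonormal_basis_expand[OF po unit, symmetric]) auto
  then have "snd p \<bullet> snd p = (\<Sum>b\<in>?B. (snd p \<bullet> b)\<^sup>2)"
    by (metis (no_types, lifting) inner_scaleR_right inner_sum_right power2_eq_square sum.cong)
  also have "\<dots> = (\<Sum>i\<le>7. (snd p \<bullet> e i)\<^sup>2)"
    using inj by (simp add: sum.reindex)
  also have "\<dots> = (\<Sum>i=1..7. (a i q \<bullet> snd p)\<^sup>2)"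
    using q by (simp add: e_def eval_nat_numeral inner_commute)
  finally show ?thesis by (simp add: q_def)
qed

lemma momenta_sum:
  "msum (a 6) p = a 6 (fst p) \<bullet> snd p" "msum (a 7) p = a 7 (fst p) \<bullet> snd p"
  "m K True p + m K False p = a 6 (a 7 (fst p)) \<bullet> snd p"
  "m K True p - m K False p = - (a 5 (fst p) \<bullet> snd p)"
proof -
  show "msum (a 6) p = a 6 (fst p) \<bullet> snd p" "msum (a 7) p = a 7 (fst p) \<bullet> snd p"
    "m K True p + m K False p = a 6 (a 7 (fst p)) \<bullet> snd p"
    by (simp_all add: msum_def m_eq Pr_def K_def inner_simps)
  have "proj (K x) - (K x - proj (K x)) = - a 5 x" for x
  proof -
    have "a 5 (a 6 (a 7 (K x))) = - a 5 x" by (simp add: K_def sort_words a_linear)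
    then have "proj (K x) + proj (K x) = K x - a 5 x"
      by (simp add: proj_def flip: scaleR_2)
    then show ?thesis by (simp add: algebra_simps)
  qed
  then show "m K True p - m K False p = - (a 5 (fst p) \<bullet> snd p)"
    by (simp add: m_eq Pr_def flip: inner_diff_left inner_minus_left)
qed

lemma energy_cotangent:
  assumes "p \<in> cotangent_S7"
  shows "energy p = snd p \<bullet> snd p" "energy p = (\<Sum>i=1..7. (a i (fst p) \<bullet> snd p)\<^sup>2)"
  using assms parseval[OF assms] by (simp_all add: energy_def mem_cotangent_S7 norm_eq_1)

lemma sum_1_numeral:
  fixes f :: "nat \<Rightarrow> real"
  shows "(\<Sum>i=1..4. f i) = f 1 + f 2 + f 3 + f 4" "(\<Sum>i=1..5. f i) = (\<Sum>i=1..4. f i) + f 5"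
    "(\<Sum>i=1..6. f i) = (\<Sum>i=1..5. f i) + f 6" "(\<Sum>i=1..7. f i) = (\<Sum>i=1..6. f i) + f 7"
  by (simp_all add: eval_nat_numeral)

lemma hamiltonians:
  assumes "p \<in> cotangent_S7"
  shows "ham_K (- 1) 0 p = H_sub A 4 p" "ham_K 1 (1/2) p = H_sub A 5 p" "ham_J p = H_sub A 6 p"
    "ham_K 1 0 p = H_sub_QH A p"
proof -
  have H: "H_sub A j p = 1/2 * (\<Sum>i=1..j. (a i (fst p) \<bullet> snd p)\<^sup>2)" for j
    by (simp add: H_sub_def a_def case_prod_unfold)
  show "ham_K (- 1) 0 p = H_sub A 4 p" "ham_K 1 (1/2) p = H_sub A 5 p" "ham_J p = H_sub A 6 p"
    unfolding H ham_K_def ham_J_def coupling_def energy_cotangent(2)[OF assms] sum_1_numeral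
    by (simp_all add: momenta_sum msum_def[of K] field_simps)
  show "ham_K 1 0 p = H_sub_QH A p"
    unfolding ham_K_def coupling_def energy_cotangent(1)[OF assms]
    by (simp add: momenta_sum H_sub_QH_def case_prod_unfold power2_norm_eq_inner flip: a_def)
qed

end

theorem theorem4p4:
  fixes A :: "nat \<Rightarrow> real^8^8"
  assumes "clifford_family A"
  shows "completely_integrable TYPE(real^14) cotangent_S7 canonical_form (H_sub A 4) \<and>
         completely_integrable TYPE(real^14) cotangent_S7 canonical_form (H_sub A 5) \<and>
         completely_integrable TYPE(real^14) cotangent_S7 canonical_form (H_sub A 6) \<and>
         completely_integrable TYPE(real^14) cotangent_S7 canonical_form (H_sub_QH A)"
proof -
  interpret clifford A by unfold_locales (rule assms)
  show ?thesis
    by (intro conjI completely_integrable_K completely_integrable_J; rule hamiltonians; assumption)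
qed

end
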